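(* Let $\Theta_0,\Theta_1$ be minimal L-systems (input-output space $\mathbb C$, $J=1$), not necessarily satisfying Hypothesis I, and let $\Theta=\Theta_0\cdot\Theta_1$ be their (general) coupling. If $V_{\Theta_0}\in\mathfrak M$, then $V_\Theta\in\mathfrak M$.
   Context: L-systems. Let $\dot A$ be a closed, densely defined symmetric operator with deficiency indices $(1,1)$ in a Hilbert space $\mathcal H$. Let $\mathcal H_+=\mathrm{Dom}(\dot A^* )$ with inner product $(f,g)_+=(f,g)+(\dot A^*f,\dot A^*g)$, and let $\mathcal H_+\subset\mathcal H\subset\mathcal H_-$ be the associated rigged Hilbert space ($\mathcal H_-$ is the dual of $\mathcal H_+$ with respect to the pairing extending the inner product of $\mathcal H$). For a bounded $\mathbb A:\mathcal H_+\to\mathcal H_-$ the adjoint $\mathbb A^*$ is again bounded $\mathcal H_+\to\mathcal H_-$; $\mathrm{Re}\,\mathbb A=(\mathbb A+\mathbb A^* )/2$, $\mathrm{Im}\,\mathbb A=(\mathbb A-\mathbb A^* )/(2i)$. An operator $T$ with $\dot A\subset T\subset\dot A^*$ belongs to $\Lambda(\dot A)$ if $\rho(T)\neq\emptyset$ and $\mathrm{Dom}(\dot A)=\mathrm{Dom}(T)\cap\mathrm{Dom}(T^* )$. A bounded $\mathbb A:\mathcal H_+\to\mathcal H_-$ is a $( * )$-extension of $T$ if $\mathbb A\supset T\supset\dot A$, $\mathbb A^*\supset T^*\supset\dot A$, and the quasi-kernel $\hat A$ of $\mathrm{Re}\,\mathbb A$ (the restriction of $\mathrm{Re}\,\mathbb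 A$ to $\{f\in\mathcal H_+:\mathrm{Re}\,\mathbb A f\in\mathcal H\}$) is self-adjoint in $\mathcal H$. An L-system is an array $\Theta=\begin{pmatrix}\mathbb A&K&1\\ \mathcal H_+\subset\mathcal H\subset\mathcal H_-&&\mathbb C\end{pmatrix}$, where $\mathbb A$ is a $( * )$-extension of some $T\in\Lambda(\dot A)$ (the main operator), $K:\mathbb C\to\mathcal H_-$ is bounded with adjoint $K^*:\mathcal H_+\to\mathbb C$, $\mathrm{Im}\,\mathbb A=KK^*$, $\mathrm{Ran}(K)=\mathrm{Ran}(\mathrm{Im}\,\mathbb A)$. It is minimal if $\dot A$ is prime (no nontrivial reducing subspace on which $\dot A$ induces a self-adjoint operator). Transfer function: $W_\Theta(z)=1-2iK^*(\mathbb A-zI)^{-1}K$, $z\in\rho(T)$; impedance function: $V_\Theta(z)=K^*(\mathrm{Re}\,\mathbb A-zI)^{-1}K$, $z\in\rho(\hat A)$ (both well defined). Von Neumann parameter and Hypothesis I. The main operator $T$ is a maximal dissipative extension of $\dot A$, and there are $g_\pm\in\ker(\dot A^*\mp iI)$, $\|g_\pm\|=1$, with $g_+-\kappa g_-\in\mathrm{Dom}(T)$, $0\le\kappa<1$; $\kappa$ is the von Neumann parameter of $T$. The L-system satisfies Hypothesis I if such $g_\pm$ can be chosen with $g_+-g_-\in\mathrm{Dom}(\hat A)$. Donoghue class $\mathfrak M$: all analytic $M:\mathbb C_+\to\mathbb C_+$ of the form $M(z)=\int_{\mathbb R}\left(\frac1{\lambda-z}-\frac{\lambda}{1+\lambda^2}\right)d\mu(\lambda)$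 with $\mu$ an infinite Borel measure with $\int_{\mathbb R}\frac{d\mu(\lambda)}{1+\lambda^2}=1$ (equivalently $M(i)=i$). Coupling under Hypothesis I (written for an ordered pair $\Theta_1,\Theta_2$). For $k=1,2$ let $\Theta_k$ act in $\mathcal H_k$, with symmetric operator $\dot A_k$, main operator $T_k$, and $g^k_\pm,\kappa_k$ as in Hypothesis I. Define $\alpha\in(0,\pi/2]$ by $\tan\alpha=\frac1{\kappa_2}\sqrt{\frac{1-\kappa_2^2}{1-\kappa_1^2}}$ if $\kappa_2\ne0$ and $\alpha=\pi/2$ if $\kappa_2=0$; define $\beta$ by $\sin\beta=\kappa_1\sin\alpha$, $\cos\beta=\frac1{\kappa_2}\cos\alpha$ if $\kappa_2\neq0$, and $\sin\beta=\kappa_1$, $\cos\beta=\sqrt{1-\kappa_1^2}$ if $\kappa_2=0$. Let $\dot A$ be the restriction of $(\dot A_1\oplus\dot A_2)^*$ to $\mathrm{Dom}(\dot A_1\oplus\dot A_2)\dot+\mathcal L_0$, where $\mathcal L_0$ is spanned by $\sin\alpha\,(g_+^1-\kappa_1g_-^1)\oplus\cos\alpha\,(g_+^2-\frac1{\kappa_2}g_-^2)$ if $\kappa_2\ne0$, and by $(g_+^1-\kappa_1g_-^1)\oplus(-\sqrt{1-\kappa_1^2}\,g_-^2)$ if $\kappa_2=0$. Then $\dot A$ is symmetric with deficiency indices $(1,1)$ in $\mathcal H_1\oplus\mathcal H_2$, with normalized deficiency vectors $G_+=\cos\alpha\,g_+^1-\sin\alpha\,g_+^2\in\ker(\dot A^*-iI)$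 and $G_-=\cos\beta\,g_-^1-\sin\beta\,g_-^2\in\ker(\dot A^*+iI)$. The operator coupling $T=T_1\uplus T_2$ is the restriction of $(\dot A_1\oplus\dot A_2)^*$ to $\mathrm{Dom}(\dot A)\dot+\mathrm{span}\{G_+-\kappa_1\kappa_2G_-\}$, a maximal dissipative extension of $\dot A$. The coupling $\Theta_1\cdot\Theta_2$ is the L-system with symmetric operator $\dot A$, main operator $T$, rigging $\mathcal H_+=\mathrm{Dom}(\dot A^* )\subset\mathcal H_1\oplus\mathcal H_2\subset\mathcal H_-$, state-space operator $\mathbb A$ the (unique) $( * )$-extension of $T$ such that the quasi-kernel of $\mathrm{Re}\,\mathbb A$ is the self-adjoint extension $\hat A$ of $\dot A$ with $G_+-G_-\in\mathrm{Dom}(\hat A)$, and $Kc=c\chi$ with $\mathrm{Im}\,\mathbb A=(\cdot,\chi)\chi$ ($\chi$ is determined up to a unimodular factor). General coupling. For arbitrary minimal L-systems $\Theta_1,\Theta_2$ with main operators $T_k$ of von Neumann parameters $\kappa_k$, let $\Theta_k'$ be the L-system with the same $\dot A_k,T_k$ whose quasi-kernel satisfies Hypothesis I (with the same $\kappa_k$). Then $W_{\Theta_k'}=\nu_kW_{\Theta_k}$ with $|\nu_k|=1$. Let $\Theta'=\Theta_1'\cdot\Theta_2'$. The coupling $\Theta=\Theta_1\cdot\Theta_2$ is the L-system that has the same symmetric operator and main operator as $\Theta'$ (so it differs from $\Theta'$ only by the choice of the quasi-kernel, with the corresponding $\mathbb A$, $K$) and transfer function $W_\Theta=(\nu_1\nu_2)^{-1}W_{\Theta'}$.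 In the claim this is applied to the ordered pair $\Theta_0,\Theta_1$. *)

theory Defs
  imports "HOL-Analysis.Analysis"
begin

section \<open>Complex Hilbert spaces\<close>

text \<open>The inner product is linear in the first and antilinear in the second argument.\<close>

class complex_hilbert = banach +
  fixes scaleC :: "complex \<Rightarrow> 'a \<Rightarrow> 'a"  (infixr \<open>*\<^sub>C\<close> 75)
    and cinner :: "'a \<Rightarrow> 'a \<Rightarrow> complex"
  assumes scaleC_add_right: "c *\<^sub>C (x + y) = c *\<^sub>C x + c *\<^sub>C y"
    and scaleC_add_left: "(c + d) *\<^sub>C x = c *\<^sub>C x + d *\<^sub>C x"
    and scaleC_scaleC: "c *\<^sub>C (d *\<^sub>C x) = (c * d) *\<^sub>C x"
    and scaleR_eq_scaleC: "r *\<^sub>R x = complex_of_real r *\<^sub>C x"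
    and cinner_commute: "cinner x y = cnj (cinner y x)"
    and cinner_add_left: "cinner (x + y) z = cinner x z + cinner y z"
    and cinner_scaleC_left: "cinner (c *\<^sub>C x) y = c * cinner x y"
    and cinner_self: "cinner x x = complex_of_real ((norm x)\<^sup>2)"

lemma scaleC_one: "1 *\<^sub>C x = (x :: 'a::complex_hilbert)"
  by (metis of_real_1 scaleR_eq_scaleC scaleR_one)

interpretation complex_vector: vector_space "scaleC :: complex \<Rightarrow> 'a \<Rightarrow> 'a::complex_hilbert"
  by unfold_locales
    (simp_all add: scaleC_add_right scaleC_add_left scaleC_scaleC scaleC_one)

instantiation prod :: (complex_hilbert, complex_hilbert) complex_hilbert
begin

definition scaleC_prod :: "complex \<Rightarrow> 'a \<times> 'b \<Rightarrow> 'a \<times> 'b" where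
  "scaleC_prod c x = (c *\<^sub>C fst x, c *\<^sub>C snd x)"

definition cinner_prod :: "'a \<times> 'b \<Rightarrow> 'a \<times> 'b \<Rightarrow> complex" where
  "cinner_prod x y = cinner (fst x) (fst y) + cinner (snd x) (snd y)"

instance
proof
  fix x y z :: "'a \<times> 'b" and c d :: complex and r :: real
  show "c *\<^sub>C (x + y) = c *\<^sub>C x + c *\<^sub>C y"
    by (simp add: scaleC_prod_def scaleC_add_right)
  show "(c + d) *\<^sub>C x = c *\<^sub>C x + d *\<^sub>C x"
    by (simp add: scaleC_prod_def scaleC_add_left)
  show "c *\<^sub>C (d *\<^sub>C x) = (c * d) *\<^sub>C x"
    by (simp add: scaleC_prod_def scaleC_scaleC)
  show "r *\<^sub>R x = complex_of_real r *\<^sub>C x"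
    by (simp add: scaleC_prod_def scaleR_prod_def scaleR_eq_scaleC)
  show "cinner x y = cnj (cinner y x)"
    by (simp add: cinner_prod_def cinner_commute[symmetric])
  show "cinner (x + y) z = cinner x z + cinner y z"
    by (simp add: cinner_prod_def cinner_add_left)
  show "cinner (c *\<^sub>C x) y = c * cinner x y"
    by (simp add: cinner_prod_def scaleC_prod_def cinner_scaleC_left algebra_simps)
  show "cinner x x = complex_of_real ((norm x)\<^sup>2)"
    by (simp add: cinner_prod_def cinner_self norm_prod_def)
qed

end

section \<open>Unbounded operators as graphs\<close>

text \<open>An operator is identified with its graph, so extension is inclusion of sets.\<close>

definition lin_operator :: "('a::complex_hilbert \<times> 'a) set \<Rightarrow> bool" where
  "lin_operator S \<longleftrightarrow> complex_vector.subspace S \<and> single_valued S"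

definition op_app :: "('a \<times> 'a) set \<Rightarrow> 'a \<Rightarrow> 'a" where
  "op_app S f = (THE u. (f, u) \<in> S)"

definition restrict_op :: "('a \<times> 'a) set \<Rightarrow> 'a set \<Rightarrow> ('a \<times> 'a) set" where
  "restrict_op S D = {(f, u) \<in> S. f \<in> D}"

definition adjoint_in :: "'a::complex_hilbert set \<Rightarrow> ('a \<times> 'a) set \<Rightarrow> ('a \<times> 'a) set" where
  "adjoint_in M S = {(g, h). g \<in> M \<and> h \<in> M \<and> (\<forall>(f, u) \<in> S. cinner u g = cinner f h)}"

abbreviation adj :: "('a::complex_hilbert \<times> 'a) set \<Rightarrow> ('a \<times> 'a) set" where
  "adj S \<equiv> adjoint_in UNIV S"

text \<open>\<open>S\<close> is a self-adjoint operator in the Hilbert space \<open>M\<close> (a closed subspace).\<close>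

definition selfadjoint_in :: "'a::complex_hilbert set \<Rightarrow> ('a \<times> 'a) set \<Rightarrow> bool" where
  "selfadjoint_in M S \<longleftrightarrow>
     lin_operator S \<and> S \<subseteq> M \<times> M \<and> M \<subseteq> closure (Domain S) \<and> adjoint_in M S = S"

abbreviation selfadjoint :: "('a::complex_hilbert \<times> 'a) set \<Rightarrow> bool" where
  "selfadjoint S \<equiv> selfadjoint_in UNIV S"

definition resolvent_set :: "('a::complex_hilbert \<times> 'a) set \<Rightarrow> complex set" where
  "resolvent_set S =
     {z. (\<forall>h. \<exists>!f. (f, h + z *\<^sub>C f) \<in> S) \<and>
         (\<exists>C. \<forall>(f, u) \<in> S. norm f \<le> C * norm (u - z *\<^sub>C f))}"

definition dissipative :: "('a::complex_hilbert \<times> 'a) set \<Rightarrow> bool" where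
  "dissipative S \<longleftrightarrow>
     lin_operator S \<and> closure (Domain S) = UNIV \<and> (\<forall>(f, u) \<in> S. Im (cinner u f) \<ge> 0)"

definition maximal_dissipative :: "('a::complex_hilbert \<times> 'a) set \<Rightarrow> bool" where
  "maximal_dissipative S \<longleftrightarrow> dissipative S \<and> (\<forall>S'. dissipative S' \<and> S \<subseteq> S' \<longrightarrow> S' = S)"

definition defect_space :: "('a::complex_hilbert \<times> 'a) set \<Rightarrow> complex \<Rightarrow> 'a set" where
  "defect_space A z = {f. (f, z *\<^sub>C f) \<in> adj A}"

text \<open>In this setting \<open>dim V = 1\<close> is unambiguous: the library assigns dimension 0, not 1,
  to infinite-dimensional spaces.\<close>

definition symmetric_11 :: "('a::complex_hilbert \<times> 'a) set \<Rightarrow> bool" where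
  "symmetric_11 A \<longleftrightarrow>
     lin_operator A \<and> closed A \<and> closure (Domain A) = UNIV \<and> A \<subseteq> adj A \<and>
     complex_vector.dim (defect_space A \<i>) = 1 \<and>
     complex_vector.dim (defect_space A (- \<i>)) = 1"

definition orth_compl :: "'a::complex_hilbert set \<Rightarrow> 'a set" where
  "orth_compl M = {g. \<forall>f \<in> M. cinner f g = 0}"

definition reducing_subspace :: "('a::complex_hilbert \<times> 'a) set \<Rightarrow> 'a set \<Rightarrow> bool" where
  "reducing_subspace A M \<longleftrightarrow>
     complex_vector.subspace M \<and> closed M \<and>
     (\<forall>(f, u) \<in> A. \<exists>(f1, u1) \<in> A \<inter> (M \<times> M). \<exists>(f2, u2) \<in> A \<inter> (orth_compl M \<times> orth_compl M).
        f = f1 + f2 \<and> u = u1 + u2)"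

definition prime_op :: "('a::complex_hilbert \<times> 'a) set \<Rightarrow> bool" where
  "prime_op A \<longleftrightarrow>
     \<not> (\<exists>M. M \<noteq> {0} \<and> reducing_subspace A M \<and> selfadjoint_in M (A \<inter> (M \<times> M)))"

definition Lambda_class :: "('a::complex_hilbert \<times> 'a) set \<Rightarrow> ('a \<times> 'a) set set" where
  "Lambda_class A =
     {T. lin_operator T \<and> A \<subseteq> T \<and> T \<subseteq> adj A \<and> resolvent_set T \<noteq> {} \<and>
         Domain A = Domain T \<inter> Domain (adj T)}"

section \<open>The rigged Hilbert space\<close>

definition plus_space :: "('a::complex_hilbert \<times> 'a) set \<Rightarrow> 'a set" where
  "plus_space A = Domain (adj A)"

definition plus_inner :: "('a::complex_hilbert \<times> 'a) set \<Rightarrow> 'a \<Rightarrow> 'a \<Rightarrow> complex" where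
  "plus_inner A f g = cinner f g + cinner (op_app (adj A) f) (op_app (adj A) g)"

definition plus_norm :: "('a::complex_hilbert \<times> 'a) set \<Rightarrow> 'a \<Rightarrow> real" where
  "plus_norm A f = sqrt (Re (plus_inner A f f))"

text \<open>An element \<open>\<phi>\<close> of the negative space is represented by the bounded antilinear functional
  \<open>f \<mapsto> (\<phi>, f)\<close> on the positive space, extended by 0 outside it so that equality of elements is
  equality of functions.\<close>

definition minus_norm :: "('a::complex_hilbert \<times> 'a) set \<Rightarrow> ('a \<Rightarrow> complex) \<Rightarrow> real" where
  "minus_norm A \<phi> = (SUP f \<in> {f \<in> plus_space A. plus_norm A f \<le> 1}. cmod (\<phi> f))"

definition minus_space :: "('a::complex_hilbert \<times> 'a) set \<Rightarrow> ('a \<Rightarrow> complex) set" where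
  "minus_space A =
     {\<phi>. (\<forall>f \<in> plus_space A. \<forall>g \<in> plus_space A. \<phi> (f + g) = \<phi> f + \<phi> g) \<and>
         (\<forall>c. \<forall>f \<in> plus_space A. \<phi> (c *\<^sub>C f) = cnj c * \<phi> f) \<and>
         (\<exists>C. \<forall>f \<in> plus_space A. cmod (\<phi> f) \<le> C * plus_norm A f) \<and>
         (\<forall>f. f \<notin> plus_space A \<longrightarrow> \<phi> f = 0)}"

definition emb :: "('a::complex_hilbert \<times> 'a) set \<Rightarrow> 'a \<Rightarrow> 'a \<Rightarrow> complex" where
  "emb A h = (\<lambda>f. if f \<in> plus_space A then cinner h f else 0)"

definition bounded_pm ::
  "('a::complex_hilbert \<times> 'a) set \<Rightarrow> ('a \<Rightarrow> 'a \<Rightarrow> complex) \<Rightarrow> bool" where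
  "bounded_pm A B \<longleftrightarrow>
     (\<forall>f \<in> plus_space A. B f \<in> minus_space A) \<and>
     (\<forall>f \<in> plus_space A. \<forall>g \<in> plus_space A. B (f + g) = (\<lambda>h. B f h + B g h)) \<and>
     (\<forall>c. \<forall>f \<in> plus_space A. B (c *\<^sub>C f) = (\<lambda>h. c * B f h)) \<and>
     (\<exists>C. \<forall>f \<in> plus_space A. minus_norm A (B f) \<le> C * plus_norm A f)"

text \<open>The adjoint is determined by \<open>(B f, g) = (f, B* g)\<close>, and \<open>(f, \<phi>)\<close> is the
  conjugate of \<open>(\<phi>, f)\<close>.\<close>

definition adj_pm ::
  "('a::complex_hilbert \<times> 'a) set \<Rightarrow> ('a \<Rightarrow> 'a \<Rightarrow> complex) \<Rightarrow> 'a \<Rightarrow> 'a \<Rightarrow> complex" where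
  "adj_pm A B g =
     (\<lambda>f. if f \<in> plus_space A \<and> g \<in> plus_space A then cnj (B f g) else 0)"

definition Re_pm ::
  "('a::complex_hilbert \<times> 'a) set \<Rightarrow> ('a \<Rightarrow> 'a \<Rightarrow> complex) \<Rightarrow> 'a \<Rightarrow> 'a \<Rightarrow> complex" where
  "Re_pm A B f = (\<lambda>g. (B f g + adj_pm A B f g) / 2)"

definition Im_pm ::
  "('a::complex_hilbert \<times> 'a) set \<Rightarrow> ('a \<Rightarrow> 'a \<Rightarrow> complex) \<Rightarrow> 'a \<Rightarrow> 'a \<Rightarrow> complex" where
  "Im_pm A B f = (\<lambda>g. (B f g - adj_pm A B f g) / (2 * \<i>))"

definition quasi_kernel ::
  "('a::complex_hilbert \<times> 'a) set \<Rightarrow> ('a \<Rightarrow> 'a \<Rightarrow> complex) \<Rightarrow> ('a \<times> 'a) set" where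
  "quasi_kernel A B = {(f, u). f \<in> plus_space A \<and> B f = emb A u}"

definition extends_pm ::
  "('a::complex_hilbert \<times> 'a) set \<Rightarrow> ('a \<Rightarrow> 'a \<Rightarrow> complex) \<Rightarrow> ('a \<times> 'a) set \<Rightarrow> bool" where
  "extends_pm A B T \<longleftrightarrow> (\<forall>(f, u) \<in> T. f \<in> plus_space A \<and> B f = emb A u)"

definition star_extension ::
  "('a::complex_hilbert \<times> 'a) set \<Rightarrow> ('a \<times> 'a) set \<Rightarrow> ('a \<Rightarrow> 'a \<Rightarrow> complex) \<Rightarrow> bool" where
  "star_extension A T B \<longleftrightarrow>
     bounded_pm A B \<and>
     extends_pm A B T \<and> A \<subseteq> T \<and>
     extends_pm A (adj_pm A B) (adj T) \<and> A \<subseteq> adj T \<and>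
     selfadjoint (quasi_kernel A (Re_pm A B))"

section \<open>L-systems\<close>

record 'a lsystem =
  sym_op :: "('a \<times> 'a) set"
  main_op :: "('a \<times> 'a) set"
  state_op :: "'a \<Rightarrow> 'a \<Rightarrow> complex"
  channel_op :: "complex \<Rightarrow> 'a \<Rightarrow> complex"

definition bounded_channel ::
  "('a::complex_hilbert \<times> 'a) set \<Rightarrow> (complex \<Rightarrow> 'a \<Rightarrow> complex) \<Rightarrow> bool" where
  "bounded_channel A K \<longleftrightarrow>
     (\<forall>c. K c \<in> minus_space A) \<and>
     (\<forall>c d. K (c + d) = (\<lambda>f. K c f + K d f)) \<and>
     (\<forall>c d. K (c * d) = (\<lambda>f. c * K d f)) \<and>
     (\<exists>C. \<forall>c. minus_norm A (K c) \<le> C * cmod c)"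

text \<open>From \<open>(K c, f) = c * cnj (K* f)\<close> with \<open>c = 1\<close>.\<close>

definition channel_adj :: "(complex \<Rightarrow> 'a \<Rightarrow> complex) \<Rightarrow> 'a \<Rightarrow> complex" where
  "channel_adj K f = cnj (K 1 f)"

definition is_lsystem :: "'a::complex_hilbert lsystem \<Rightarrow> bool" where
  "is_lsystem \<Theta> \<longleftrightarrow>
     (let A = sym_op \<Theta>; T = main_op \<Theta>; B = state_op \<Theta>; K = channel_op \<Theta> in
        symmetric_11 A \<and> T \<in> Lambda_class A \<and> star_extension A T B \<and>
        bounded_channel A K \<and>
        (\<forall>f \<in> plus_space A. Im_pm A B f = K (channel_adj K f)) \<and>
        range K = Im_pm A B ` plus_space A)"

definition minimal_lsystem :: "'a::complex_hilbert lsystem \<Rightarrow> bool" where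
  "minimal_lsystem \<Theta> \<longleftrightarrow> is_lsystem \<Theta> \<and> prime_op (sym_op \<Theta>)"

definition Re_state :: "'a::complex_hilbert lsystem \<Rightarrow> 'a \<Rightarrow> 'a \<Rightarrow> complex" where
  "Re_state \<Theta> = Re_pm (sym_op \<Theta>) (state_op \<Theta>)"

definition qk :: "'a::complex_hilbert lsystem \<Rightarrow> ('a \<times> 'a) set" where
  "qk \<Theta> = quasi_kernel (sym_op \<Theta>) (Re_state \<Theta>)"

text \<open>\<open>resolvent_pm A B z \<phi>\<close> is \<open>(B - z I)\<^sup>-\<^sup>1 \<phi>\<close>, where \<open>I\<close> embeds the positive into the
  negative space.\<close>

definition resolvent_pm ::
  "('a::complex_hilbert \<times> 'a) set \<Rightarrow> ('a \<Rightarrow> 'a \<Rightarrow> complex) \<Rightarrow> complex \<Rightarrow> ('a \<Rightarrow> complex) \<Rightarrow> 'a" where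
  "resolvent_pm A B z \<phi> =
     (THE f. f \<in> plus_space A \<and> (\<lambda>g. B f g - emb A (z *\<^sub>C f) g) = \<phi>)"

text \<open>Linear maps from \<open>\<complex>\<close> to \<open>\<complex>\<close> are identified with their value at 1. The values are
  meaningful for \<open>z\<close> in the resolvent set of the main operator, respectively of the quasi-kernel.\<close>

definition transfer_fun :: "'a::complex_hilbert lsystem \<Rightarrow> complex \<Rightarrow> complex" where
  "transfer_fun \<Theta> z =
     1 - 2 * \<i> * channel_adj (channel_op \<Theta>)
       (resolvent_pm (sym_op \<Theta>) (state_op \<Theta>) z (channel_op \<Theta> 1))"

definition impedance_fun :: "'a::complex_hilbert lsystem \<Rightarrow> complex \<Rightarrow> complex" where
  "impedance_fun \<Theta> z =
     channel_adj (channel_op \<Theta>)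
       (resolvent_pm (sym_op \<Theta>) (Re_state \<Theta>) z (channel_op \<Theta> 1))"

section \<open>The Donoghue class\<close>

abbreviation upper_half_plane :: "complex set" where
  "upper_half_plane \<equiv> {z. Im z > 0}"

text \<open>Membership concerns only the restriction of \<open>M\<close> to the upper half-plane.\<close>

definition donoghue_class :: "(complex \<Rightarrow> complex) set" where
  "donoghue_class =
     {M. M holomorphic_on upper_half_plane \<and>
         M ` upper_half_plane \<subseteq> upper_half_plane \<and>
         (\<exists>\<mu> :: real measure. sets \<mu> = sets borel \<and> emeasure \<mu> UNIV = \<infinity> \<and>
            (\<integral>\<^sup>+ t. ennreal (1 / (1 + t\<^sup>2)) \<partial>\<mu>) = 1 \<and>
            (\<forall>z \<in> upper_half_plane.
               M z = (\<integral>t. 1 / (complex_of_real t - z) - complex_of_real (t / (1 + t\<^sup>2)) \<partial>\<mu>)))}"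

section \<open>Von Neumann parameter and Hypothesis I\<close>

definition neumann_vectors ::
  "('a::complex_hilbert \<times> 'a) set \<Rightarrow> ('a \<times> 'a) set \<Rightarrow> real \<Rightarrow> 'a \<Rightarrow> 'a \<Rightarrow> bool" where
  "neumann_vectors A T \<kappa> gp gm \<longleftrightarrow>
     maximal_dissipative T \<and>
     gp \<in> defect_space A \<i> \<and> gm \<in> defect_space A (- \<i>) \<and> norm gp = 1 \<and> norm gm = 1 \<and>
     gp - complex_of_real \<kappa> *\<^sub>C gm \<in> Domain T \<and> 0 \<le> \<kappa> \<and> \<kappa> < 1"

definition hypothesis_I ::
  "'a::complex_hilbert lsystem \<Rightarrow> real \<Rightarrow> 'a \<Rightarrow> 'a \<Rightarrow> bool" where
  "hypothesis_I \<Theta> \<kappa> gp gm \<longleftrightarrow>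
     neumann_vectors (sym_op \<Theta>) (main_op \<Theta>) \<kappa> gp gm \<and> gp - gm \<in> Domain (qk \<Theta>)"

section \<open>Coupling\<close>

definition direct_sum_op ::
  "('a \<times> 'a) set \<Rightarrow> ('b \<times> 'b) set \<Rightarrow> (('a \<times> 'b) \<times> ('a \<times> 'b)) set" where
  "direct_sum_op A1 A2 = {((f1, f2), (u1, u2)). (f1, u1) \<in> A1 \<and> (f2, u2) \<in> A2}"

definition coupling_angles :: "real \<Rightarrow> real \<Rightarrow> real \<Rightarrow> real \<Rightarrow> bool" where
  "coupling_angles \<kappa>1 \<kappa>2 \<alpha> \<beta> \<longleftrightarrow>
     0 < \<alpha> \<and> \<alpha> \<le> pi / 2 \<and>
     (if \<kappa>2 \<noteq> 0
      then \<alpha> \<noteq> pi / 2 \<and> tan \<alpha> = 1 / \<kappa>2 * sqrt ((1 - \<kappa>2\<^sup>2) / (1 - \<kappa>1\<^sup>2)) \<and>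
           sin \<beta> = \<kappa>1 * sin \<alpha> \<and> cos \<beta> = 1 / \<kappa>2 * cos \<alpha>
      else \<alpha> = pi / 2 \<and> sin \<beta> = \<kappa>1 \<and> cos \<beta> = sqrt (1 - \<kappa>1\<^sup>2))"

definition coupling_L0 ::
  "real \<Rightarrow> real \<Rightarrow> real \<Rightarrow> 'a::complex_hilbert \<Rightarrow> 'a \<Rightarrow> 'b::complex_hilbert \<Rightarrow> 'b \<Rightarrow> 'a \<times> 'b" where
  "coupling_L0 \<kappa>1 \<kappa>2 \<alpha> gp1 gm1 gp2 gm2 =
     (if \<kappa>2 \<noteq> 0
      then (sin \<alpha> *\<^sub>R (gp1 - \<kappa>1 *\<^sub>R gm1), cos \<alpha> *\<^sub>R (gp2 - (1 / \<kappa>2) *\<^sub>R gm2))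
      else (gp1 - \<kappa>1 *\<^sub>R gm1, - (sqrt (1 - \<kappa>1\<^sup>2) *\<^sub>R gm2)))"

definition add_span :: "'a::complex_hilbert set \<Rightarrow> 'a \<Rightarrow> 'a set" where
  "add_span D v = {f + w | f w. f \<in> D \<and> w \<in> complex_vector.span {v}}"

definition coupling_hyp_I ::
  "'a::complex_hilbert lsystem \<Rightarrow> real \<Rightarrow> 'a \<Rightarrow> 'a \<Rightarrow>
   'b::complex_hilbert lsystem \<Rightarrow> real \<Rightarrow> 'b \<Rightarrow> 'b \<Rightarrow> ('a \<times> 'b) lsystem \<Rightarrow> bool" where
  "coupling_hyp_I \<Theta>1 \<kappa>1 gp1 gm1 \<Theta>2 \<kappa>2 gp2 gm2 \<Theta> \<longleftrightarrow>
     hypothesis_I \<Theta>1 \<kappa>1 gp1 gm1 \<and> hypothesis_I \<Theta>2 \<kappa>2 gp2 gm2 \<and> is_lsystem \<Theta> \<and>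
     (\<exists>\<alpha> \<beta>. coupling_angles \<kappa>1 \<kappa>2 \<alpha> \<beta> \<and>
        (let S = direct_sum_op (sym_op \<Theta>1) (sym_op \<Theta>2);
             Gp = (cos \<alpha> *\<^sub>R gp1, - (sin \<alpha> *\<^sub>R gp2));
             Gm = (cos \<beta> *\<^sub>R gm1, - (sin \<beta> *\<^sub>R gm2))
         in sym_op \<Theta> =
              restrict_op (adj S)
                (add_span (Domain S) (coupling_L0 \<kappa>1 \<kappa>2 \<alpha> gp1 gm1 gp2 gm2)) \<and>
            main_op \<Theta> =
              restrict_op (adj S) (add_span (Domain (sym_op \<Theta>)) (Gp - (\<kappa>1 * \<kappa>2) *\<^sub>R Gm)) \<and>
            Gp - Gm \<in> Domain (qk \<Theta>)))"

text \<open>The coupling is a relation: the channel operator is determined only up to a unimodular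
  factor.\<close>

definition coupling ::
  "'a::complex_hilbert lsystem \<Rightarrow> 'b::complex_hilbert lsystem \<Rightarrow> ('a \<times> 'b) lsystem \<Rightarrow> bool" where
  "coupling \<Theta>1 \<Theta>2 \<Theta> \<longleftrightarrow>
     (\<exists>\<Theta>1' \<Theta>2' \<Theta>' \<kappa>1 \<kappa>2 gp1 gm1 gp2 gm2 \<nu>1 \<nu>2.
        is_lsystem \<Theta>1' \<and> sym_op \<Theta>1' = sym_op \<Theta>1 \<and> main_op \<Theta>1' = main_op \<Theta>1 \<and>
        is_lsystem \<Theta>2' \<and> sym_op \<Theta>2' = sym_op \<Theta>2 \<and> main_op \<Theta>2' = main_op \<Theta>2 \<and>
        coupling_hyp_I \<Theta>1' \<kappa>1 gp1 gm1 \<Theta>2' \<kappa>2 gp2 gm2 \<Theta>' \<and>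
        cmod \<nu>1 = 1 \<and> cmod \<nu>2 = 1 \<and>
        (\<forall>z \<in> resolvent_set (main_op \<Theta>1). transfer_fun \<Theta>1' z = \<nu>1 * transfer_fun \<Theta>1 z) \<and>
        (\<forall>z \<in> resolvent_set (main_op \<Theta>2). transfer_fun \<Theta>2' z = \<nu>2 * transfer_fun \<Theta>2 z) \<and>
        is_lsystem \<Theta> \<and> sym_op \<Theta> = sym_op \<Theta>' \<and> main_op \<Theta> = main_op \<Theta>' \<and>
        (\<forall>z \<in> resolvent_set (main_op \<Theta>).
           transfer_fun \<Theta> z = inverse (\<nu>1 * \<nu>2) * transfer_fun \<Theta>' z))"

end

theory Submission
  imports Defs "HOL-Probability.Probability"
begin

text \<open>
  If \<open>V\<close> is the impedance function of an L-system with state-space operator \<open>\<A>\<close> and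
  \<open>V(\<i>) = \<i>\<close>, then \<open>f = (Re \<A> - \<i>)\<^sup>-\<^sup>1 K 1\<close> satisfies \<open>\<A> f = \<i> f\<close>, so by maximality
  \<open>\<i>\<close> is an eigenvalue of the main operator and \<open>\<kappa> = 0\<close>. The coupling has von Neumann
  parameter \<open>\<kappa>\<^sub>0 \<kappa>\<^sub>1 = 0\<close>, so its main operator has the unit eigenvector \<open>G\<^sub>+\<close> for \<open>\<i>\<close>.
  Whatever the quasi-kernel \<open>S\<close> is, a unimodular multiple \<open>g\<close> of \<open>G\<^sub>+\<close> then gives
  \<open>V(z) = - \<i> + (z + \<i>) (g + (z - \<i>) (S - z)\<^sup>-\<^sup>1 g, g)\<close>, and \<open>g\<close> is not in the domain of \<open>S\<close>.
  The representing measure is built from the Cayley transform \<open>U\<close> of \<open>S\<close>: Fejer means and Helly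
  selection give a probability measure with moments \<open>(U\<^sup>k g, g)\<close>, which the substitution
  \<open>t = cot (\<theta>/2)\<close> carries to the real line. No mass sits at infinity by the mean ergodic
  theorem, and the measure is infinite because \<open>g\<close> is not in the domain of \<open>S\<close>.
\<close>

section \<open>Hilbert space preliminaries\<close>

lemma cinner_add_right: "cinner (x::'a::complex_hilbert) (y + z) = cinner x y + cinner x z"
  by (metis cinner_add_left cinner_commute complex_cnj_add)

lemma cinner_scaleC_right: "cinner (x::'a::complex_hilbert) (c *\<^sub>C y) = cnj c * cinner x y"
  by (metis cinner_scaleC_left cinner_commute complex_cnj_mult)

lemma scaleC_minus1: "(-1) *\<^sub>C x = - (x::'a::complex_hilbert)"
  by (simp add: complex_vector.scale_minus_left scaleC_one)

lemma cinner_minus_left: "cinner (- x) (y::'a::complex_hilbert) = - cinner x y"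
  by (metis cinner_scaleC_left mult_minus1 scaleC_minus1)

lemma cinner_minus_right: "cinner x (- y::'a::complex_hilbert) = - cinner x y"
  by (metis cinner_commute cinner_minus_left complex_cnj_minus)

lemma cinner_diff_left: "cinner (x - y) (z::'a::complex_hilbert) = cinner x z - cinner y z"
  by (metis cinner_add_left cinner_minus_left diff_conv_add_uminus)

lemma cinner_diff_right: "cinner (x::'a::complex_hilbert) (y - z) = cinner x y - cinner x z"
  by (metis cinner_add_right cinner_minus_right diff_conv_add_uminus)

lemma cinner_zero_left [simp]: "cinner 0 (y::'a::complex_hilbert) = 0"
  using cinner_diff_left[of 0 0 y] by simp

lemma cinner_zero_right [simp]: "cinner (x::'a::complex_hilbert) 0 = 0"
  using cinner_diff_right[of x 0 0] by simp

lemmas cinner_simps = cinner_add_left cinner_add_right cinner_diff_left cinner_diff_right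
  cinner_scaleC_left cinner_scaleC_right cinner_minus_left cinner_minus_right

lemma cinner_sum_left: "cinner (\<Sum>i\<in>I. f i) (y::'a::complex_hilbert) = (\<Sum>i\<in>I. cinner (f i) y)"
  by (induction I rule: infinite_finite_induct) (simp_all add: cinner_add_left)

lemma cinner_sum_right: "cinner (x::'a::complex_hilbert) (\<Sum>i\<in>I. f i) = (\<Sum>i\<in>I. cinner x (f i))"
  by (induction I rule: infinite_finite_induct) (simp_all add: cinner_add_right)

lemma cinner_self_eq_0_iff [simp]: "cinner x x = 0 \<longleftrightarrow> (x::'a::complex_hilbert) = 0"
  by (simp add: cinner_self)

lemma norm_sq_eq_cinner: "(norm (x::'a::complex_hilbert))\<^sup>2 = Re (cinner x x)"
  by (simp add: cinner_self)

lemma norm_scaleC: "norm (c *\<^sub>C (x::'a::complex_hilbert)) = cmod c * norm x"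
proof -
  have "cinner (c *\<^sub>C x) (c *\<^sub>C x) = (c * cnj c) * cinner x x"
    by (simp add: cinner_simps)
  also have "\<dots> = of_real ((cmod c)\<^sup>2) * of_real ((norm x)\<^sup>2)"
    by (simp only: complex_norm_square cinner_self)
  finally have "cinner (c *\<^sub>C x) (c *\<^sub>C x) = of_real ((cmod c)\<^sup>2) * of_real ((norm x)\<^sup>2)" .
  then have "(norm (c *\<^sub>C x))\<^sup>2 = (cmod c * norm x)\<^sup>2"
    by (simp only: norm_sq_eq_cinner[of "c *\<^sub>C x"] of_real_mult[symmetric] Re_complex_of_real
        power_mult_distrib)
  then show ?thesis
    by (simp add: power2_eq_iff_nonneg)
qed

text \<open>Pythagoras after removing the component of \<open>x\<close> along \<open>y\<close>. It
  yields Cauchy-Schwarz and, in \<open>closed_subspace_orthogonal_vector\<close>, the orthogonality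
  of the remainder at a nearest point.\<close>

lemma norm_diff_scaleC_projection:
  fixes x y :: "'a::complex_hilbert"
  assumes "y \<noteq> 0"
  shows "(norm (x - (cinner x y / of_real ((norm y)\<^sup>2)) *\<^sub>C y))\<^sup>2
           = (norm x)\<^sup>2 - (cmod (cinner x y))\<^sup>2 / (norm y)\<^sup>2"
proof -
  define n where "n = complex_of_real ((norm y)\<^sup>2)"
  have n: "n \<noteq> 0" "cinner y y = n" "cnj n = n" using assms by (auto simp: n_def cinner_self)
  let ?a = "cinner x y"
  have "cinner (x - (?a / n) *\<^sub>C y) (x - (?a / n) *\<^sub>C y) = cinner x x - ?a * cnj ?a / n"
    using n(1) by (simp add: cinner_simps n(2,3) cinner_commute[of y x] field_simps)
  also have "?a * cnj ?a / n = of_real ((cmod ?a)\<^sup>2 / (norm y)\<^sup>2)"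
    by (simp only: n_def complex_norm_square[symmetric] of_real_divide)
  finally show ?thesis
    unfolding n_def by (simp only: norm_sq_eq_cinner minus_complex.sel Re_complex_of_real)
qed

lemma cinner_Cauchy_Schwarz: "cmod (cinner x y) \<le> norm x * norm (y::'a::complex_hilbert)"
proof (cases "y = 0")
  case False
  have "0 \<le> (norm x)\<^sup>2 - (cmod (cinner x y))\<^sup>2 / (norm y)\<^sup>2"
    by (subst norm_diff_scaleC_projection[OF False, symmetric]) simp
  then have "(cmod (cinner x y))\<^sup>2 \<le> (norm x * norm y)\<^sup>2"
    using False by (simp add: field_simps power_mult_distrib)
  then show ?thesis by (rule power2_le_imp_le) simp
qed simp

lemma bounded_linear_cinner_left: "bounded_linear (\<lambda>x. cinner x (y::'a::complex_hilbert))"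
  by (rule bounded_linear_intro[where K = "norm y"])
    (simp_all add: cinner_add_left scaleR_eq_scaleC cinner_scaleC_left cinner_Cauchy_Schwarz
      scaleR_conv_of_real)

lemma bounded_linear_cinner_right: "bounded_linear (\<lambda>y. cinner (x::'a::complex_hilbert) y)"
proof (rule bounded_linear_intro[where K = "norm x"])
  show "cmod (cinner x y) \<le> norm y * norm x" for y
    using cinner_Cauchy_Schwarz[of x y] by (simp add: mult.commute)
qed (simp_all add: cinner_add_right scaleR_eq_scaleC cinner_scaleC_right scaleR_conv_of_real)

lemma bounded_linear_scaleC: "bounded_linear (\<lambda>x. c *\<^sub>C (x::'a::complex_hilbert))"
  by (rule bounded_linear_intro[where K = "cmod c"])
    (simp_all add: scaleC_add_right scaleR_eq_scaleC scaleC_scaleC mult.commute norm_scaleC)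

section \<open>Density, nearest points and orthogonal vectors\<close>

lemma parallelogram_law:
  "(norm (x + y))\<^sup>2 + (norm (x - y))\<^sup>2 = 2 * (norm x)\<^sup>2 + 2 * (norm (y::'a::complex_hilbert))\<^sup>2"
  by (simp add: norm_sq_eq_cinner cinner_simps)

lemma orthogonal_dense_eq_0:
  fixes k :: "'a::complex_hilbert"
  assumes "closure D = UNIV" and "\<And>f. f \<in> D \<Longrightarrow> cinner f k = 0"
  shows "k = 0"
proof -
  have "k \<in> closure D" using assms(1) by simp
  then obtain s where s: "\<And>n. s n \<in> D" "s \<longlonglongrightarrow> k"
    using closure_sequential by blast
  have "(\<lambda>n. cinner (s n) k) \<longlonglongrightarrow> cinner k k"
    by (rule bounded_linear.tendsto[OF bounded_linear_cinner_left s(2)])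
  then have "(\<lambda>n. 0) \<longlonglongrightarrow> cinner k k" using s(1) assms(2) by simp
  then show ?thesis by (simp add: LIMSEQ_const_iff)
qed

text \<open>A minimizing sequence in \<open>M\<close> is Cauchy: midpoints of its terms stay in
  \<open>M\<close>, hence at distance at least \<open>d\<close> from \<open>x\<close>, and the
  parallelogram law then bounds the distance between the terms.\<close>

lemma exists_nearest_point:
  fixes x :: "'a::complex_hilbert"
  assumes sub: "complex_vector.subspace M" and cl: "closed M"
  obtains m where "m \<in> M" "\<And>m'. m' \<in> M \<Longrightarrow> norm (x - m) \<le> norm (x - m')"
proof -
  have "M \<noteq> {}" using complex_vector.subspace_0[OF sub] by auto
  define d where "d = infdist x M"
  have d_le: "d \<le> norm (x - m)" if "m \<in> M" for m
    using infdist_le[OF that, of x] by (simp add: d_def dist_norm)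
  have d0: "d \<ge> 0" by (simp add: d_def infdist_nonneg)
  have "\<exists>m\<in>M. norm (x - m) < d + 1 / Suc n" for n
  proof -
    have "infdist x M < d + 1 / Suc n" by (simp add: d_def)
    then show ?thesis
      using \<open>M \<noteq> {}\<close> unfolding infdist_notempty[OF \<open>M \<noteq> {}\<close>]
      by (subst (asm) cINF_less_iff) (auto simp: dist_norm intro!: bdd_belowI[of _ 0])
  qed
  then obtain s where s: "\<And>n. s n \<in> M" "\<And>n. norm (x - s n) < d + 1 / Suc n"
    by metis
  have diff: "(norm (s n - s k))\<^sup>2 \<le> 2 * ((norm (x - s n))\<^sup>2 - d\<^sup>2) + 2 * ((norm (x - s k))\<^sup>2 - d\<^sup>2)"
    for n k
  proof -
    let ?c = "(1/2) *\<^sub>C (s n + s k)"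
    have "?c \<in> M" using s(1) sub by (simp add: complex_vector.subspace_def)
    then have "d \<le> norm (x - ?c)" by (rule d_le)
    then have "d\<^sup>2 \<le> (norm (x - ?c))\<^sup>2" using d0 by (rule power_mono)
    moreover have "(x - s n) + (x - s k) = 2 *\<^sub>C (x - ?c)"
      by (simp add: complex_vector.scale_right_diff_distrib scaleC_scaleC scaleC_one)
        (metis (no_types) one_add_one scaleC_add_left scaleC_one)
    then have "(norm ((x - s n) + (x - s k)))\<^sup>2 = 4 * (norm (x - ?c))\<^sup>2"
      by (simp add: norm_scaleC power_mult_distrib)
    moreover have "norm ((x - s n) - (x - s k)) = norm (s n - s k)"
      by (simp add: norm_minus_commute)
    ultimately show ?thesis
      using parallelogram_law[of "x - s n" "x - s k"] by (simp add: algebra_simps)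
  qed
  have lim: "(\<lambda>n. norm (x - s n)) \<longlonglongrightarrow> d"
  proof (rule tendsto_sandwich)
    show "\<forall>\<^sub>F n in sequentially. norm (x - s n) \<le> d + 1 / Suc n"
      using s(2) by (auto intro!: always_eventually less_imp_le)
    show "\<forall>\<^sub>F n in sequentially. d \<le> norm (x - s n)"
      using s(1) d_le by (auto intro!: always_eventually)
    show "(\<lambda>n. d + 1 / real (Suc n)) \<longlonglongrightarrow> d"
      using tendsto_add[OF tendsto_const LIMSEQ_inverse_real_of_nat, of d]
      by (simp add: inverse_eq_divide)
  qed simp
  then have "(\<lambda>n. (norm (x - s n))\<^sup>2 - d\<^sup>2) \<longlonglongrightarrow> d\<^sup>2 - d\<^sup>2"
    by (intro tendsto_intros)
  then have lim0: "(\<lambda>n. (norm (x - s n))\<^sup>2 - d\<^sup>2) \<longlonglongrightarrow> 0" by simp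
  have "Cauchy s"
  proof (rule CauchyI)
    fix e :: real assume "e > 0"
    then have "e\<^sup>2 / 4 > 0" by simp
    then obtain N where N: "\<And>n. n \<ge> N \<Longrightarrow> \<bar>(norm (x - s n))\<^sup>2 - d\<^sup>2\<bar> < e\<^sup>2 / 4"
      using LIMSEQ_D[OF lim0] by (metis diff_zero real_norm_def)
    have "norm (s n - s k) < e" if "n \<ge> N" "k \<ge> N" for n k
    proof -
      have "(norm (s n - s k))\<^sup>2 < e\<^sup>2"
        using diff[of n k] N[OF that(1)] N[OF that(2)] unfolding abs_less_iff by argo
      then show ?thesis using \<open>e > 0\<close> by (auto intro: power2_less_imp_less)
    qed
    then show "\<exists>N. \<forall>n\<ge>N. \<forall>k\<ge>N. norm (s n - s k) < e" by blast
  qed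
  then obtain m where m: "s \<longlonglongrightarrow> m" using Cauchy_convergent convergent_def by blast
  have "m \<in> M" using closed_sequentially[OF cl] s(1) m by blast
  moreover have "(\<lambda>n. norm (x - s n)) \<longlonglongrightarrow> norm (x - m)" by (intro tendsto_intros m)
  then have "norm (x - m) = d" using lim LIMSEQ_unique by blast
  ultimately show thesis using that d_le by simp
qed

text \<open>Take \<open>y = x - m\<close> with \<open>x\<close> outside \<open>M\<close> and
  \<open>m\<close> nearest to it. Were \<open>y\<close> not orthogonal to some \<open>m'\<close> in
  \<open>M\<close>, adding to \<open>m\<close> the projection of \<open>y\<close> onto
  \<open>m'\<close> would bring it closer to \<open>x\<close>.\<close>

lemma closed_subspace_orthogonal_vector:
  fixes M :: "'a::complex_hilbert set"
  assumes sub: "complex_vector.subspace M" and cl: "closed M" and "M \<noteq> UNIV"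
  obtains y where "y \<noteq> 0" "\<And>m. m \<in> M \<Longrightarrow> cinner m y = 0"
proof -
  obtain x where x: "x \<notin> M" using assms(3) by blast
  obtain m where m: "m \<in> M" "\<And>m'. m' \<in> M \<Longrightarrow> norm (x - m) \<le> norm (x - m')"
    using exists_nearest_point[OF sub cl] by blast
  define y where "y = x - m"
  have "cinner y m' = 0" if m': "m' \<in> M" for m'
  proof (cases "m' = 0")
    case False
    let ?c = "cinner y m' / of_real ((norm m')\<^sup>2)"
    have "m + ?c *\<^sub>C m' \<in> M"
      using m(1) m' sub by (simp add: complex_vector.subspace_def)
    then have "norm y \<le> norm (y - ?c *\<^sub>C m')"
      using m(2) by (metis y_def diff_diff_eq)
    then have "(norm y)\<^sup>2 \<le> (norm (y - ?c *\<^sub>C m'))\<^sup>2" by (simp add: power_mono)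
    then have "(cmod (cinner y m'))\<^sup>2 / (norm m')\<^sup>2 \<le> 0"
      by (simp only: norm_diff_scaleC_projection[OF False])
    then show ?thesis using False by (simp add: divide_le_0_iff)
  qed simp
  then have "\<And>m'. m' \<in> M \<Longrightarrow> cinner m' y = 0" by (metis cinner_commute complex_cnj_zero)
  moreover have "y \<noteq> 0" using x m(1) by (auto simp: y_def)
  ultimately show thesis using that by blast
qed

section \<open>Self-adjoint operators and the Cayley transform\<close>

lemma lin_operatorD:
  assumes "lin_operator S"
  shows lin_operator_add: "(f, u) \<in> S \<Longrightarrow> (g, v) \<in> S \<Longrightarrow> (f + g, u + v) \<in> S"
    and lin_operator_scaleC: "(f, u) \<in> S \<Longrightarrow> (c *\<^sub>C f, c *\<^sub>C u) \<in> S"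
    and lin_operator_diff: "(f, u) \<in> S \<Longrightarrow> (g, v) \<in> S \<Longrightarrow> (f - g, u - v) \<in> S"
    and lin_operator_zero: "(0, 0) \<in> S"
proof -
  have sub: "complex_vector.subspace S"
    using assms by (simp add: lin_operator_def)
  show "(f, u) \<in> S \<Longrightarrow> (g, v) \<in> S \<Longrightarrow> (f + g, u + v) \<in> S"
    using complex_vector.subspace_add[OF sub, of "(f, u)" "(g, v)"] by simp
  show "(f, u) \<in> S \<Longrightarrow> (c *\<^sub>C f, c *\<^sub>C u) \<in> S"
    using complex_vector.subspace_scale[OF sub, of "(f, u)" c] by (simp add: scaleC_prod_def)
  show "(f, u) \<in> S \<Longrightarrow> (g, v) \<in> S \<Longrightarrow> (f - g, u - v) \<in> S"
    using complex_vector.subspace_diff[OF sub, of "(f, u)" "(g, v)"] by simp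
  show "(0, 0) \<in> S"
    using complex_vector.subspace_0[OF sub] by (simp add: zero_prod_def)
qed

lemma adj_iff: "(g, h) \<in> adj S \<longleftrightarrow> (\<forall>f u. (f, u) \<in> S \<longrightarrow> cinner u g = cinner f h)"
  by (auto simp: adjoint_in_def)

lemma adj_antimono: "S \<subseteq> S' \<Longrightarrow> adj S' \<subseteq> adj S"
  by (auto simp: adjoint_in_def)

lemma selfadjoint_symmetric:
  assumes "selfadjoint S" "(f, u) \<in> S" "(g, v) \<in> S"
  shows "cinner u g = cinner f v"
  using assms by (metis adj_iff selfadjoint_in_def)

lemma selfadjoint_imp_lin_operator: "selfadjoint S \<Longrightarrow> lin_operator S"
  by (simp add: selfadjoint_in_def)

lemma selfadjoint_imp_dense: "selfadjoint S \<Longrightarrow> closure (Domain S) = UNIV"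
  by (auto simp: selfadjoint_in_def)

lemma selfadjoint_Im_eq_0:
  assumes "selfadjoint S" "(f, u) \<in> S"
  shows "Im (cinner u f) = 0"
  using selfadjoint_symmetric[OF assms assms(2)]
  by (metis cinner_commute cnj.simps(2) neg_equal_zero)

lemma selfadjoint_eigenvector_eq_0:
  assumes "selfadjoint S" "(f, z *\<^sub>C f) \<in> S" "Im z \<noteq> 0"
  shows "f = 0"
  using selfadjoint_Im_eq_0[OF assms(1,2)] assms(3) by (simp add: cinner_scaleC_left cinner_self)

text \<open>The cross terms cancel because \<open>cinner u f\<close> is real. Hence
  \<open>S - i\<close> is bounded below, which makes its range closed.\<close>

lemma selfadjoint_norm_shift:
  assumes "selfadjoint S" "(f, u) \<in> S"
  shows "(norm (u - \<i> *\<^sub>C f))\<^sup>2 = (norm u)\<^sup>2 + (norm f)\<^sup>2"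
proof -
  have "cinner f u = cinner u f" using selfadjoint_symmetric[OF assms assms(2)] by simp
  then show ?thesis by (simp add: norm_sq_eq_cinner cinner_simps)
qed

text \<open>An adjoint is cut out by equations that are continuous in both components, so its graph
  is closed.\<close>

lemma selfadjoint_closed:
  assumes sa: "selfadjoint S" and mem: "\<And>n. (f n, u n) \<in> S"
    and "f \<longlonglongrightarrow> f0" "u \<longlonglongrightarrow> u0"
  shows "(f0, u0) \<in> S"
proof -
  have "cinner v f0 = cinner g u0" if "(g, v) \<in> S" for g v
  proof -
    have "(\<lambda>n. cinner v (f n)) \<longlonglongrightarrow> cinner v f0" "(\<lambda>n. cinner g (u n)) \<longlonglongrightarrow> cinner g u0"
      using assms(3,4) by (auto intro: bounded_linear.tendsto[OF bounded_linear_cinner_right])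
    moreover have "cinner v (f n) = cinner g (u n)" for n
      using selfadjoint_symmetric[OF sa that mem] .
    ultimately show ?thesis using LIMSEQ_unique by auto
  qed
  then have "(f0, u0) \<in> adj S" by (simp add: adj_iff)
  then show ?thesis using sa by (simp add: selfadjoint_in_def)
qed

text \<open>The range \<open>R\<close> of \<open>S - i\<close> is a closed subspace. A vector
  orthogonal to it is an eigenvector of the adjoint of \<open>S\<close>, that is of \<open>S\<close>
  itself, for -i, and hence zero.\<close>

lemma selfadjoint_surj_shift_i:
  fixes S :: "('a::complex_hilbert \<times> 'a) set"
  assumes sa: "selfadjoint S"
  obtains f u where "(f, u) \<in> S" "h = u - \<i> *\<^sub>C f"
proof -
  note lin = selfadjoint_imp_lin_operator[OF sa]
  define R where "R = {u - \<i> *\<^sub>C f | f u. (f, u) \<in> S}"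
  have "complex_vector.subspace R"
  proof (rule complex_vector.subspaceI)
    show "0 \<in> R"
      unfolding R_def mem_Collect_eq
      by (rule exI[of _ 0], rule exI[of _ 0]) (simp add: lin_operator_zero[OF lin])
    fix x y c assume "x \<in> R"
    then obtain f u where fu: "(f, u) \<in> S" "x = u - \<i> *\<^sub>C f" unfolding R_def by blast
    have "c *\<^sub>C x = c *\<^sub>C u - \<i> *\<^sub>C (c *\<^sub>C f)"
      by (simp add: fu complex_vector.scale_right_diff_distrib scaleC_scaleC mult.commute)
    then show "c *\<^sub>C x \<in> R"
      using lin_operator_scaleC[OF lin fu(1), of c] unfolding R_def by blast
    assume "y \<in> R"
    then obtain g v where gv: "(g, v) \<in> S" "y = v - \<i> *\<^sub>C g" unfolding R_def by blast
    have "x + y = (u + v) - \<i> *\<^sub>C (f + g)"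
      by (simp add: fu gv scaleC_add_right)
    then show "x + y \<in> R"
      using lin_operator_add[OF lin fu(1) gv(1)] unfolding R_def by blast
  qed
  moreover have "closed R"
    unfolding closed_sequential_limits
  proof (intro allI impI, elim conjE)
    fix x l assume "\<forall>n. x n \<in> R" and lim: "x \<longlonglongrightarrow> l"
    then have "\<forall>n. \<exists>f u. (f, u) \<in> S \<and> x n = u - \<i> *\<^sub>C f"
      unfolding R_def by blast
    then obtain f u where fu: "\<And>n. (f n, u n) \<in> S" "\<And>n. x n = u n - \<i> *\<^sub>C f n" by metis
    \<comment> \<open>By \<open>selfadjoint_norm_shift\<close> the preimages are controlled by the
      images, so the \<open>f n\<close> inherit the Cauchy property of the
      \<open>x n\<close>.\<close>
    have le: "norm (f n - f m) \<le> norm (x n - x m)" for n m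
    proof -
      have "(norm (f n - f m))\<^sup>2 \<le> (norm ((u n - u m) - \<i> *\<^sub>C (f n - f m)))\<^sup>2"
        by (simp add: selfadjoint_norm_shift[OF sa lin_operator_diff[OF lin fu(1) fu(1)]])
      also have "(u n - u m) - \<i> *\<^sub>C (f n - f m) = x n - x m"
        by (simp add: fu(2) complex_vector.scale_right_diff_distrib)
      finally show ?thesis by (rule power2_le_imp_le) simp
    qed
    have "Cauchy x" using lim convergent_Cauchy convergent_def by blast
    then have "Cauchy f"
      unfolding Cauchy_iff using le by (meson order_le_less_trans)
    then obtain f0 where f0: "f \<longlonglongrightarrow> f0" using Cauchy_convergent convergent_def by blast
    have "(\<lambda>n. x n + \<i> *\<^sub>C f n) \<longlonglongrightarrow> l + \<i> *\<^sub>C f0"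
      by (intro tendsto_add lim bounded_linear.tendsto[OF bounded_linear_scaleC] f0)
    then have "u \<longlonglongrightarrow> l + \<i> *\<^sub>C f0" by (simp add: fu(2))
    then have "(f0, l + \<i> *\<^sub>C f0) \<in> S" using selfadjoint_closed[OF sa fu(1) f0] by blast
    moreover have "l = (l + \<i> *\<^sub>C f0) - \<i> *\<^sub>C f0" by simp
    ultimately show "l \<in> R" unfolding R_def by blast
  qed
  moreover have "y = 0" if "\<And>m. m \<in> R \<Longrightarrow> cinner m y = 0" for y
  proof -
    have "cinner u y = cinner f (cnj \<i> *\<^sub>C y)" if "(f, u) \<in> S" for f u
    proof -
      have "u - \<i> *\<^sub>C f \<in> R" using that unfolding R_def by blast
      then have "cinner (u - \<i> *\<^sub>C f) y = 0" using \<open>\<And>m. m \<in> R \<Longrightarrow> cinner m y = 0\<close> by blast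
      then show ?thesis by (simp add: cinner_simps del: complex_cnj_i)
    qed
    then have "(y, cnj \<i> *\<^sub>C y) \<in> adj S" by (simp add: adj_iff)
    then have "(y, cnj \<i> *\<^sub>C y) \<in> S" using sa by (simp add: selfadjoint_in_def)
    then show ?thesis by (rule selfadjoint_eigenvector_eq_0[OF sa]) simp
  qed
  ultimately have "R = UNIV"
    using closed_subspace_orthogonal_vector[of R] by blast
  then have "h \<in> R" by simp
  then show thesis using that unfolding R_def by blast
qed

text \<open>The operator \<open>(S + i)(S - i)^(-1)\<close>. For self-adjoint \<open>S\<close> the
  description is total and unambiguous, since \<open>S - i\<close> maps the domain bijectively onto
  the whole space.\<close>

definition cayley :: "('a::complex_hilbert \<times> 'a) set \<Rightarrow> 'a \<Rightarrow> 'a" where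
  "cayley S x = (THE y. \<exists>f u. (f, u) \<in> S \<and> x = u - \<i> *\<^sub>C f \<and> y = u + \<i> *\<^sub>C f)"

lemma cayley_apply:
  assumes sa: "selfadjoint S" and fu: "(f, u) \<in> S"
  shows "cayley S (u - \<i> *\<^sub>C f) = u + \<i> *\<^sub>C f"
  unfolding cayley_def
proof (rule the_equality)
  show "\<exists>f' u'. (f', u') \<in> S \<and> u - \<i> *\<^sub>C f = u' - \<i> *\<^sub>C f' \<and> u + \<i> *\<^sub>C f = u' + \<i> *\<^sub>C f'"
    using fu by blast
next
  fix y assume "\<exists>f' u'. (f', u') \<in> S \<and> u - \<i> *\<^sub>C f = u' - \<i> *\<^sub>C f' \<and> y = u' + \<i> *\<^sub>C f'"
  then obtain f' u' where *: "(f', u') \<in> S" "u - \<i> *\<^sub>C f = u' - \<i> *\<^sub>C f'" "y = u' + \<i> *\<^sub>C f'"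
    by blast
  have "(f - f', u - u') \<in> S"
    using lin_operator_diff[OF selfadjoint_imp_lin_operator[OF sa] fu *(1)] .
  moreover have eq: "u - u' = \<i> *\<^sub>C (f - f')"
    using *(2) by (simp add: complex_vector.scale_right_diff_distrib algebra_simps)
  ultimately have "f - f' = 0"
    using selfadjoint_eigenvector_eq_0[OF sa, of "f - f'" \<i>] by simp
  then show "y = u + \<i> *\<^sub>C f" using eq *(3) by simp
qed

text \<open>Only nonnegative powers of the Cayley transform occur below, and inner products between
  them reduce to moments up to conjugation, so a linear isometry is the working interface.\<close>

locale hilbert_isometry =
  fixes U :: "'a::complex_hilbert \<Rightarrow> 'a"
  assumes U_add: "U (x + y) = U x + U y"
    and U_scaleC: "U (c *\<^sub>C x) = c *\<^sub>C U x"
    and cinner_U_U: "cinner (U x) (U y) = cinner x y"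

text \<open>For \<open>x = (S - i) f\<close> and \<open>y = (S - i) g\<close> the two inner products
  differ by \<open>2 i ((f, S g) - (S f, g))\<close>, which is zero by symmetry.\<close>

lemma hilbert_isometry_cayley:
  assumes sa: "selfadjoint S"
  shows "hilbert_isometry (cayley S)"
proof
  note lin = selfadjoint_imp_lin_operator[OF sa]
  fix x y :: 'a and c
  obtain f u where fu: "(f, u) \<in> S" "x = u - \<i> *\<^sub>C f" by (rule selfadjoint_surj_shift_i[OF sa])
  obtain g v where gv: "(g, v) \<in> S" "y = v - \<i> *\<^sub>C g" by (rule selfadjoint_surj_shift_i[OF sa])
  have Ux: "cayley S x = u + \<i> *\<^sub>C f" and Uy: "cayley S y = v + \<i> *\<^sub>C g"
    using fu gv cayley_apply[OF sa] by blast+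
  have "x + y = (u + v) - \<i> *\<^sub>C (f + g)"
    by (simp add: fu gv scaleC_add_right)
  then show "cayley S (x + y) = cayley S x + cayley S y"
    using cayley_apply[OF sa lin_operator_add[OF lin fu(1) gv(1)]]
    by (simp add: Ux Uy scaleC_add_right)
  have "c *\<^sub>C x = c *\<^sub>C u - \<i> *\<^sub>C (c *\<^sub>C f)"
    by (simp add: fu complex_vector.scale_right_diff_distrib scaleC_scaleC mult.commute)
  then show "cayley S (c *\<^sub>C x) = c *\<^sub>C cayley S x"
    using cayley_apply[OF sa lin_operator_scaleC[OF lin fu(1), of c]]
    by (simp add: Ux scaleC_add_right scaleC_scaleC mult.commute)
  have "cinner u g = cinner f v" using selfadjoint_symmetric[OF sa fu(1) gv(1)] .
  then show "cinner (cayley S x) (cayley S y) = cinner x y"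
    unfolding Ux Uy by (simp add: fu(2) gv(2) cinner_simps algebra_simps)
qed

text \<open>If \<open>x = (S - i) f\<close> then \<open>U x - x = 2 i f\<close> for the Cayley
  transform \<open>U\<close>. This translates density of the domain, and the absence of a vector
  from it, into statements about \<open>U\<close>.\<close>

lemma Domain_eq_range_cayley_minus_id:
  assumes sa: "selfadjoint S"
  shows "Domain S = range (\<lambda>x. cayley S x - x)"
proof (intro equalityI subsetI)
  note lin = selfadjoint_imp_lin_operator[OF sa]
  fix f assume "f \<in> Domain S"
  then obtain u where u: "(f, u) \<in> S" by auto
  let ?c = "1 / (2 * \<i>)"
  have "cayley S (?c *\<^sub>C u - \<i> *\<^sub>C (?c *\<^sub>C f)) - (?c *\<^sub>C u - \<i> *\<^sub>C (?c *\<^sub>C f)) = (2 * \<i> * ?c) *\<^sub>C f"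
    unfolding cayley_apply[OF sa lin_operator_scaleC[OF lin u]]
    by (simp add: scaleC_scaleC flip: scaleC_add_left)
  also have "\<dots> = f" by (simp add: scaleC_one)
  finally show "f \<in> range (\<lambda>x. cayley S x - x)" by (rule range_eqI[OF sym])
next
  note lin = selfadjoint_imp_lin_operator[OF sa]
  fix f assume "f \<in> range (\<lambda>x. cayley S x - x)"
  then obtain x where x: "f = cayley S x - x" by blast
  obtain g v where gv: "(g, v) \<in> S" "x = v - \<i> *\<^sub>C g" by (rule selfadjoint_surj_shift_i[OF sa])
  have "f = (2 * \<i>) *\<^sub>C g"
    using cayley_apply[OF sa gv(1)] by (simp add: x gv(2) flip: scaleC_add_left)
  then show "f \<in> Domain S" using lin_operator_scaleC[OF lin gv(1)] by blast
qed

section \<open>Neumann series of an isometry and resolvents\<close>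

context hilbert_isometry
begin

lemma norm_U [simp]: "norm (U x) = norm x"
proof -
  have "(norm (U x))\<^sup>2 = (norm x)\<^sup>2" by (simp only: norm_sq_eq_cinner cinner_U_U)
  then show ?thesis by (simp add: power2_eq_iff_nonneg)
qed

lemma bounded_linear_U: "bounded_linear U"
  by (rule bounded_linear_intro[where K = 1]) (simp_all add: U_add U_scaleC scaleR_eq_scaleC)

lemma norm_U_pow [simp]: "norm ((U ^^ k) x) = norm x"
  by (induction k) simp_all

definition neumann_series :: "complex \<Rightarrow> 'a \<Rightarrow> 'a" where
  "neumann_series w h = (\<Sum>k. w ^ k *\<^sub>C (U ^^ k) h)"

lemma neumann_series_sums:
  assumes "cmod w < 1"
  shows "(\<lambda>k. w ^ k *\<^sub>C (U ^^ k) h) sums neumann_series w h"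
proof -
  have "summable (\<lambda>k. norm (w ^ k *\<^sub>C (U ^^ k) h))"
    using assms by (simp add: norm_scaleC norm_power summable_mult2 summable_geometric)
  then show ?thesis
    unfolding neumann_series_def by (rule summable_sums[OF summable_norm_cancel])
qed

lemma neumann_series_solves:
  assumes "cmod w < 1"
  shows "neumann_series w h - w *\<^sub>C U (neumann_series w h) = h"
proof -
  note s = neumann_series_sums[OF assms, of h]
  have "(\<lambda>k. w *\<^sub>C U (w ^ k *\<^sub>C (U ^^ k) h)) sums (w *\<^sub>C U (neumann_series w h))"
    by (intro bounded_linear.sums[OF bounded_linear_scaleC] bounded_linear.sums[OF bounded_linear_U] s)
  then have "(\<lambda>k. w ^ Suc k *\<^sub>C (U ^^ Suc k) h) sums (w *\<^sub>C U (neumann_series w h))"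
    by (simp add: U_scaleC scaleC_scaleC)
  moreover have "(\<lambda>k. w ^ Suc k *\<^sub>C (U ^^ Suc k) h) sums (neumann_series w h - h)"
    using s by (subst sums_Suc_iff) (simp add: scaleC_one)
  ultimately have "w *\<^sub>C U (neumann_series w h) = neumann_series w h - h" using sums_unique2 by blast
  then show ?thesis by simp
qed

end

abbreviation disc_coord :: "complex \<Rightarrow> complex" where
  "disc_coord z \<equiv> (z - \<i>) / (z + \<i>)"

lemma cmod_disc_coord_less_1:
  assumes "Im z > 0"
  shows "z + \<i> \<noteq> 0" "cmod (disc_coord z) < 1"
proof -
  show "z + \<i> \<noteq> 0" using assms by (auto simp: complex_eq_iff)
  moreover have "cmod (z - \<i>) < cmod (z + \<i>)"
    using assms by (simp add: cmod_def power2_eq_square algebra_simps)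
  ultimately show "cmod (disc_coord z) < 1" by (simp add: norm_divide)
qed

text \<open>The Cayley transform turns \<open>S - z\<close> into \<open>I - w U\<close> with
  \<open>w = disc_coord z\<close>: for \<open>x = (S - i) f\<close> one has
  \<open>(z + i)(x - w U x) = 2 i (S - z) f = (S - z)(U x - x)\<close>. As \<open>w\<close> lies in
  the unit disc, the Neumann series inverts the left side.\<close>

lemma selfadjoint_resolvent:
  fixes S :: "('a::complex_hilbert \<times> 'a) set"
    and h :: 'a
  assumes sa: "selfadjoint S" and z: "Im z > 0"
  defines "x \<equiv> (1 / (z + \<i>)) *\<^sub>C hilbert_isometry.neumann_series (cayley S) (disc_coord z) h"
  shows "(cayley S x - x, h + z *\<^sub>C (cayley S x - x)) \<in> S"
proof -
  interpret hilbert_isometry "cayley S" by (rule hilbert_isometry_cayley[OF sa])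
  note lin = selfadjoint_imp_lin_operator[OF sa]
  let ?w = "disc_coord z" and ?U = "cayley S"
  obtain f u where fu: "(f, u) \<in> S" "x = u - \<i> *\<^sub>C f" by (rule selfadjoint_surj_shift_i[OF sa])
  have Ux: "?U x = u + \<i> *\<^sub>C f" using cayley_apply[OF sa fu(1)] fu(2) by simp
  have "(z + \<i>) *\<^sub>C (x - ?w *\<^sub>C ?U x) = h"
    using neumann_series_solves[OF cmod_disc_coord_less_1(2)[OF z], of h] cmod_disc_coord_less_1(1)[OF z]
    by (simp add: x_def U_scaleC scaleC_scaleC complex_vector.scale_right_diff_distrib scaleC_one)
  then have "(z + \<i>) *\<^sub>C x - (z - \<i>) *\<^sub>C ?U x = h"
    using cmod_disc_coord_less_1(1)[OF z]
    by (simp add: scaleC_scaleC complex_vector.scale_right_diff_distrib)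
  \<comment> \<open>A linear identity in \<open>u\<close> and \<open>f\<close>, used with
    \<open>a = z + i\<close> and \<open>b = z - i\<close>, whose difference is 2i and whose sum is
    2z.\<close>
  moreover have "a *\<^sub>C x - b *\<^sub>C ?U x = (a - b) *\<^sub>C u - (\<i> * (a + b)) *\<^sub>C f" for a b
    unfolding Ux unfolding fu(2)
    by (simp add: scaleC_add_left scaleC_add_right complex_vector.scale_right_diff_distrib
        complex_vector.scale_left_diff_distrib scaleC_scaleC distrib_left mult.commute)
  ultimately have "h = (2 * \<i>) *\<^sub>C u - (2 * \<i> * z) *\<^sub>C f"
    by (simp add: mult_ac)
  moreover have "?U x - x = (2 * \<i>) *\<^sub>C f"
    unfolding Ux unfolding fu(2) by (simp flip: scaleC_add_left)
  ultimately show ?thesis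
    using lin_operator_scaleC[OF lin fu(1), of "2 * \<i>"] by (simp add: scaleC_scaleC mult_ac)
qed

section \<open>The spectral measure of a vector under an isometry\<close>

lemma borel_measurable_cis [measurable]: "cis \<in> borel_measurable borel"
  by (intro borel_measurable_continuous_onI continuous_intros)

lemma has_bochner_integral_cis:
  fixes l :: int
  shows "has_bochner_integral lborel (\<lambda>\<theta>. indicator {0..2*pi} \<theta> *\<^sub>R cis (l * \<theta>))
           (if l = 0 then 2 * pi else 0)"
proof (cases "l = 0")
  case True
  have "has_bochner_integral lborel (\<lambda>\<theta>. indicator {0..2*pi} \<theta> *\<^sub>R (1::complex)) (measure lborel {0..2*pi} *\<^sub>R 1)"
    by (intro has_bochner_integral_scaleR_left has_bochner_integral_real_indicator) auto
  then show ?thesis using True by (simp add: scaleR_conv_of_real)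
next
  case False
  have cis1: "cis (2 * (pi * real_of_int l)) = 1"
    using cis_multiple_2pi[of "real_of_int l"] by (simp add: mult_ac)
  have "has_bochner_integral lborel (\<lambda>\<theta>. indicator {0..2*pi} \<theta> *\<^sub>R cis (l * \<theta>))
     (cis (l * (2*pi)) / (\<i> * l) - cis (l * (0::real)) / (\<i> * l))"
  proof (rule has_bochner_integral_FTC_Icc)
    fix x :: real
    have "((\<lambda>x. exp (\<i> * (l * x)) / (\<i> * l)) has_field_derivative exp (\<i> * (l * x))) (at (of_real x :: complex))"
      using False by (auto intro!: derivative_eq_intros simp: mult_ac)
    then have "((\<lambda>x. exp (\<i> * (l * complex_of_real x)) / (\<i> * l)) has_vector_derivative exp (\<i> * (l * x)))
       (at x within {0..2*pi})"
      by (rule has_vector_derivative_real_field)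
    then show "((\<lambda>x. cis (l * x) / (\<i> * l)) has_vector_derivative cis (l * x)) (at x within {0..2*pi})"
      by (simp add: cis_conv_exp)
  qed (auto intro!: continuous_intros)
  then show ?thesis using False cis1 by (simp add: mult_ac)
qed

section \<open>Fejer means and the trigonometric moment problem\<close>

context hilbert_isometry
begin

definition moment :: "'a \<Rightarrow> nat \<Rightarrow> complex" where
  "moment g k = cinner ((U ^^ k) g) g"

text \<open>The Gram matrix of the orbit of \<open>g\<close> is Toeplitz, because an isometry lets
  common powers cancel.\<close>

lemma cinner_U_pow_add: "cinner ((U ^^ (n + k)) g) ((U ^^ k) g) = moment g n"
  by (induction k) (simp_all add: moment_def cinner_U_U)

text \<open>Up to the factor 1/(2 pi), the Fejer mean of the formal Fourier series built from the
  moments. The squared norm makes positivity evident, and the sign in the exponent makes integration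
  against \<open>cis (n * \<theta>)\<close> return \<open>moment g n\<close>.\<close>

definition fejer_density :: "'a \<Rightarrow> nat \<Rightarrow> real \<Rightarrow> real" where
  "fejer_density g N \<theta> = (norm (\<Sum>k<N. cis (- (k * \<theta>)) *\<^sub>C (U ^^ k) g))\<^sup>2 / (2 * pi * N)"

lemma fejer_density_nonneg [simp]: "fejer_density g N \<theta> \<ge> 0"
  by (simp add: fejer_density_def)

lemma fejer_density_expand:
  "complex_of_real (fejer_density g N \<theta>) =
     (\<Sum>j<N. \<Sum>k<N. cis (of_int (int k - int j) * \<theta>) * cinner ((U ^^ j) g) ((U ^^ k) g)) / (2 * pi * N)"
proof -
  have "complex_of_real ((norm (\<Sum>k<N. cis (- (k * \<theta>)) *\<^sub>C (U ^^ k) g))\<^sup>2)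
     = (\<Sum>j<N. \<Sum>k<N. cis (- (j * \<theta>)) * cnj (cis (- (k * \<theta>))) * cinner ((U ^^ j) g) ((U ^^ k) g))"
    by (simp only: cinner_self[symmetric] cinner_sum_left cinner_sum_right cinner_scaleC_left
        cinner_scaleC_right sum_distrib_left mult_ac) (rule sum.swap)
  also have "\<dots> = (\<Sum>j<N. \<Sum>k<N. cis (of_int (int k - int j) * \<theta>) * cinner ((U ^^ j) g) ((U ^^ k) g))"
    by (intro sum.cong refl) (simp add: cis_cnj cis_mult algebra_simps)
  finally show ?thesis
    by (simp add: fejer_density_def del: of_real_power)
qed

lemma continuous_fejer_density: "continuous_on X (fejer_density g N)"
proof -
  have "fejer_density g N = (\<lambda>\<theta>. Re ((\<Sum>j<N. \<Sum>k<N. cis (of_int (int k - int j) * \<theta>) *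
      cinner ((U ^^ j) g) ((U ^^ k) g)) / (2 * pi * N)))"
    by (rule ext) (simp only: fejer_density_expand[symmetric] Re_complex_of_real)
  then show ?thesis
    unfolding divide_inverse by (simp only:) (intro continuous_intros)
qed

lemma borel_measurable_fejer_density [measurable]: "fejer_density g N \<in> borel_measurable borel"
  by (rule borel_measurable_continuous_onI[OF continuous_fejer_density])

text \<open>Orthogonality of the characters keeps only the pairs with \<open>j = n + k\<close>, and
  exactly \<open>N - n\<close> values of \<open>k\<close> have such a \<open>j\<close> below
  \<open>N\<close>.\<close>

lemma has_bochner_integral_fejer_density:
  assumes "N > 0"
  shows "has_bochner_integral lborel
    (\<lambda>\<theta>. (indicator {0..2*pi} \<theta> * fejer_density g N \<theta>) *\<^sub>R cis (n * \<theta>))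
    (real (N - n) / N * moment g n)"
proof -
  let ?c = "\<lambda>j k. cinner ((U ^^ j) g) ((U ^^ k) g) / (2 * pi * N)"
  let ?l = "\<lambda>j k. int n + int k - int j"
  have "has_bochner_integral lborel
    (\<lambda>\<theta>. \<Sum>j<N. \<Sum>k<N. (indicator {0..2*pi} \<theta> *\<^sub>R cis (?l j k * \<theta>)) * ?c j k)
    (\<Sum>j<N. \<Sum>k<N. (if ?l j k = 0 then 2 * pi else 0) * ?c j k)"
    by (intro has_bochner_integral_sum has_bochner_integral_mult_left has_bochner_integral_cis)
  moreover have "(\<Sum>j<N. \<Sum>k<N. (indicator {0..2*pi} \<theta> *\<^sub>R cis (?l j k * \<theta>)) * ?c j k)
     = (indicator {0..2*pi} \<theta> * fejer_density g N \<theta>) *\<^sub>R cis (n * \<theta>)" for \<theta> :: real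
  proof -
    have "(\<Sum>j<N. \<Sum>k<N. (indicator {0..2*pi} \<theta> *\<^sub>R cis (?l j k * \<theta>)) * ?c j k)
      = (\<Sum>j<N. \<Sum>k<N. indicator {0..2*pi} \<theta> * cis (n * \<theta>) *
            (cis (of_int (int k - int j) * \<theta>) * cinner ((U ^^ j) g) ((U ^^ k) g)) / (2 * pi * N))"
    proof (intro sum.cong refl)
      fix j k
      have "cis (?l j k * \<theta>) = cis (n * \<theta>) * cis (of_int (int k - int j) * \<theta>)"
        by (simp add: cis_mult algebra_simps)
      then show "indicator {0..2*pi} \<theta> *\<^sub>R cis (?l j k * \<theta>) * ?c j k = indicator {0..2*pi} \<theta> * cis (n * \<theta>) *
            (cis (of_int (int k - int j) * \<theta>) * cinner ((U ^^ j) g) ((U ^^ k) g)) / (2 * pi * N)"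
        by (simp only: scaleR_conv_of_real of_real_indicator) simp
    qed
    also have "\<dots> = indicator {0..2*pi} \<theta> * cis (n * \<theta>) * complex_of_real (fejer_density g N \<theta>)"
      by (simp only: fejer_density_expand sum_distrib_left sum_divide_distrib times_divide_eq_right)
    finally show ?thesis
      by (simp add: scaleR_conv_of_real of_real_indicator mult_ac)
  qed
  moreover have "(\<Sum>j<N. \<Sum>k<N. (if ?l j k = 0 then 2 * pi else 0) * ?c j k)
      = real (N - n) / N * moment g n"
  proof -
    have "(\<Sum>j<N. \<Sum>k<N. (if ?l j k = 0 then 2 * pi else 0) * ?c j k)
       = (\<Sum>k<N. \<Sum>j<N. if j = n + k then moment g n / N else 0)"
      by (subst sum.swap, intro sum.cong refl) (auto simp: cinner_U_pow_add)
    \<comment> \<open>\<open>n + k < N\<close> is equivalent to \<open>k < N - n\<close> also for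
      \<open>n \<ge> N\<close>, where truncated subtraction gives 0.\<close>
    also have "\<dots> = (\<Sum>k<N. if k < N - n then moment g n / N else 0)"
      by (intro sum.cong refl) (auto simp: sum.delta)
    also have "\<dots> = (\<Sum>k<N - n. moment g n / N)"
      by (intro sum.mono_neutral_cong_right) auto
    finally show ?thesis by simp
  qed
  ultimately show ?thesis by simp
qed

text \<open>The trigonometric moment theorem for the positive definite sequence
  \<open>moment g\<close>. The Fejer densities define probability measures on a fixed compact
  interval, hence a tight family. Moments pass to a weak limit because characters are bounded and
  continuous, and the damping factors tend to 1.\<close>

theorem spectral_measure_exists:
  assumes g: "norm g = 1"
  obtains \<nu> where "real_distribution \<nu>" "\<And>k. (\<integral>\<theta>. cis (real k * \<theta>) \<partial>\<nu>) = moment g k"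
proof -
  \<comment> \<open>\<open>Suc N\<close> keeps the divisor in the Fejer density positive.\<close>
  define d where "d N \<theta> = indicator {0..2*pi} \<theta> * fejer_density g (Suc N) \<theta>" for N and \<theta> :: real
  have [measurable]: "d N \<in> borel_measurable borel" for N unfolding d_def by measurable
  have d_nonneg: "d N \<theta> \<ge> 0" for N \<theta> by (simp add: d_def)
  define \<mu> where "\<mu> N = density lborel (\<lambda>\<theta>. ennreal (d N \<theta>))" for N
  have int: "has_bochner_integral lborel (\<lambda>\<theta>. d N \<theta> *\<^sub>R cis (n * \<theta>)) (real (Suc N - n) / Suc N * moment g n)" for N n
    unfolding d_def by (rule has_bochner_integral_fejer_density) simp
  have moment_0: "moment g 0 = 1" using g by (simp add: moment_def cinner_self)
  have "has_bochner_integral lborel (d N) 1" for N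
    using has_bochner_integral_Re[OF int[of N 0]] by (simp add: moment_0)
  then have total: "(\<integral>\<^sup>+\<theta>. ennreal (d N \<theta>) \<partial>lborel) = 1" for N
    using nn_integral_eq_integral[of lborel "d N"] d_nonneg by (simp add: has_bochner_integral_iff)
  have rd: "real_distribution (\<mu> N)" for N
    by (intro real_distribution.intro prob_spaceI)
       (simp_all add: \<mu>_def emeasure_density total real_distribution_axioms_def)
  have "tight \<mu>"
    unfolding tight_def
  proof (intro conjI allI impI)
    fix e :: real assume "e > 0"
    \<comment> \<open>Tightness is stated with half-open intervals; the left end -1 lets one of them
      contain all of \<open>[0, 2 pi]\<close>.\<close>
    have "measure (\<mu> n) {-1<..2*pi} = 1" for n
    proof -
      interpret real_distribution "\<mu> n" by (rule rd)
      have "emeasure (\<mu> n) {-1<..2*pi} = (\<integral>\<^sup>+\<theta>. ennreal (d n \<theta>) \<partial>lborel)"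
        unfolding \<mu>_def
        by (subst emeasure_density) (auto intro!: nn_integral_cong simp: d_def indicator_def)
      then show ?thesis by (simp add: total emeasure_eq_measure)
    qed
    moreover have "-1 < 2 * pi" using pi_gt_zero by linarith
    ultimately show "\<exists>a b. a < b \<and> (\<forall>n. measure (\<mu> n) {a<..b} > 1 - e)"
      using \<open>e > 0\<close> by (intro exI[of _ "-1"] exI[of _ "2*pi"]) auto
  qed (rule rd)
  then obtain r M where r: "strict_mono r" and M: "real_distribution M" "weak_conv_m (\<mu> \<circ> id \<circ> r) M"
    using tight_imp_convergent_subsubsequence[of \<mu> id] strict_mono_id by blast
  have "(\<integral>\<theta>. cis (real k * \<theta>) \<partial>M) = moment g k" for k
  proof -
    have "(\<lambda>n. \<integral>\<theta>. cis (real k * \<theta>) \<partial>((\<mu> \<circ> id \<circ> r) n)) \<longlonglongrightarrow> (\<integral>\<theta>. cis (real k * \<theta>) \<partial>M)"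
      by (rule weak_conv_imp_integral_bdd_continuous_conv[where B = 1])
         (auto simp: rd M(1) M(2)[unfolded comp_def id_def] cis_conv_exp intro!: continuous_intros)
    moreover have "(\<integral>\<theta>. cis (real k * \<theta>) \<partial>(\<mu> N)) = real (Suc N - k) / Suc N * moment g k" for N
      unfolding \<mu>_def
      by (subst integral_density) (use int[of N k] in \<open>simp_all add: has_bochner_integral_iff d_nonneg\<close>)
    ultimately have "(\<lambda>n. real (Suc (r n) - k) / Suc (r n) * moment g k) \<longlonglongrightarrow> (\<integral>\<theta>. cis (real k * \<theta>) \<partial>M)"
      by simp
    moreover have "(\<lambda>n. real (Suc n - k) / Suc n) \<longlonglongrightarrow> 1"
    proof (rule Lim_transform_eventually)
      show "(\<lambda>n. 1 - real k * (1 / Suc n)) \<longlonglongrightarrow> 1"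
        using tendsto_diff[OF tendsto_const[of 1] tendsto_mult_right_zero[OF LIMSEQ_inverse_real_of_nat, of "real k"]]
        by (simp add: inverse_eq_divide)
      show "\<forall>\<^sub>F n in sequentially. 1 - real k * (1 / Suc n) = real (Suc n - k) / Suc n"
        using eventually_ge_at_top[of k]
        by eventually_elim (simp add: of_nat_diff field_simps)
    qed
    then have "(\<lambda>n. real (Suc (r n) - k) / Suc (r n)) \<longlonglongrightarrow> 1"
      using LIMSEQ_subseq_LIMSEQ[OF _ r] by (force simp: comp_def)
    then have "(\<lambda>n. complex_of_real (real (Suc (r n) - k) / Suc (r n)) * moment g k) \<longlonglongrightarrow> of_real 1 * moment g k"
      by (intro tendsto_mult tendsto_of_real tendsto_const)
    ultimately show ?thesis using LIMSEQ_unique by fastforce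
  qed
  then show thesis using that M(1) by blast
qed

end

text \<open>Summation by parts. Stated for vectors, it serves twice in
  \<open>nn_integral_inverse_infinite\<close>: for the powers of \<open>cis \<theta>\<close> and for
  the orbit of \<open>g\<close>.\<close>

lemma weighted_telescope_sum:
  fixes a :: "nat \<Rightarrow> 'v::real_vector"
  shows "(\<Sum>k<N. real (N - k) *\<^sub>R (a k - a (Suc k))) = real N *\<^sub>R a 0 - (\<Sum>k<N. a (Suc k))"
proof (induction N)
  case (Suc N)
  have "(\<Sum>k<Suc N. real (Suc N - k) *\<^sub>R (a k - a (Suc k)))
      = (\<Sum>k<Suc N. real (N - k) *\<^sub>R (a k - a (Suc k))) + (\<Sum>k<Suc N. a k - a (Suc k))"
    unfolding sum.distrib[symmetric]
    by (intro sum.cong refl) (simp add: Suc_diff_le scaleR_left_distrib add.commute)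
  also have "(\<Sum>k<Suc N. a k - a (Suc k)) = a 0 - a (Suc N)"
    by (rule sum_lessThan_telescope')
  also have "(\<Sum>k<Suc N. real (N - k) *\<^sub>R (a k - a (Suc k))) = real N *\<^sub>R a 0 - (\<Sum>k<N. a (Suc k))"
    using Suc by simp
  finally show ?case by (simp add: scaleR_left_distrib algebra_simps)
qed simp

section \<open>The mean ergodic theorem\<close>

context hilbert_isometry
begin

lemma U_pow_add: "(U ^^ k) (x + y) = (U ^^ k) x + (U ^^ k) y"
  by (induction k) (simp_all add: U_add)

lemma U_diff: "U (x - y) = U x - U y"
  using bounded_linear_U by (rule bounded_linear.linear[THEN linear_diff])

text \<open>On the range of \<open>U - I\<close> the sum telescopes to two boundary terms. That
  range is dense and averaging does not increase norms, so it suffices to approximate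
  \<open>h\<close> from it.\<close>

lemma mean_ergodic:
  assumes dense: "closure (range (\<lambda>x. U x - x)) = UNIV"
  shows "(\<lambda>N. (1 / real N) *\<^sub>R (\<Sum>k<N. (U ^^ k) h)) \<longlonglongrightarrow> 0"
proof (rule LIMSEQ_I)
  fix e :: real assume "e > 0"
  have "h \<in> closure (range (\<lambda>x. U x - x))" using dense by simp
  then obtain x where x: "norm (h - (U x - x)) < e / 2"
    using \<open>e > 0\<close> unfolding closure_approachable
    by (metis (no_types, lifting) dist_commute dist_norm half_gt_zero rangeE)
  \<comment> \<open>Beyond this \<open>K\<close> the boundary terms, together at most
    \<open>2 * norm x\<close>, stay below \<open>N * (e / 2)\<close>.\<close>
  obtain K where K: "real K > 4 * norm x / e" using reals_Archimedean2 by blast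
  show "\<exists>K. \<forall>N\<ge>K. norm ((1 / real N) *\<^sub>R (\<Sum>k<N. (U ^^ k) h) - 0) < e"
  proof (intro exI[of _ "Suc K"] allI impI)
    fix N assume N: "N \<ge> Suc K"
    then have N0: "real N > 0" by simp
    have "(U ^^ k) h = (U ^^ k) (h - (U x - x)) + ((U ^^ Suc k) x - (U ^^ k) x)" for k
    proof -
      have "(U ^^ k) (U x) = (U ^^ k) (U x - x) + (U ^^ k) x" by (simp flip: U_pow_add)
      then have "(U ^^ k) (U x - x) = (U ^^ Suc k) x - (U ^^ k) x" by (simp add: funpow_swap1)
      moreover have "(U ^^ k) h = (U ^^ k) (h - (U x - x)) + (U ^^ k) (U x - x)"
        by (simp flip: U_pow_add)
      ultimately show ?thesis by simp
    qed
    then have "(\<Sum>k<N. (U ^^ k) h) = (\<Sum>k<N. (U ^^ k) (h - (U x - x))) + ((U ^^ N) x - (U ^^ 0) x)"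
      by (simp only: sum.distrib sum_lessThan_telescope[of "\<lambda>k. (U ^^ k) x"])
    also have "norm \<dots> \<le> N * norm (h - (U x - x)) + (norm x + norm x)"
      by (intro norm_triangle_mono order_trans[OF norm_sum] order_trans[OF norm_triangle_ineq4]) simp_all
    finally have le: "norm (\<Sum>k<N. (U ^^ k) h) \<le> N * norm (h - (U x - x)) + 2 * norm x" by simp
    have "4 * norm x / e < N" using K N by linarith
    then have "2 * norm x < N * (e / 2)" using \<open>e > 0\<close> by (simp add: field_simps)
    moreover have "N * norm (h - (U x - x)) < N * (e / 2)" using x N0 by (intro mult_strict_left_mono)
    ultimately have "norm (\<Sum>k<N. (U ^^ k) h) < N * e" using le by argo
    then show "norm ((1 / real N) *\<^sub>R (\<Sum>k<N. (U ^^ k) h) - 0) < e"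
      using N0 by (simp add: field_simps)
  qed
qed

end

section \<open>The orbit of a vector inside L2 of its spectral measure\<close>

locale spectral_measure = hilbert_isometry U + real_distribution \<nu>
  for U :: "'a::complex_hilbert \<Rightarrow> 'a" and g :: 'a and \<nu> :: "real measure" +
  assumes moment_eq: "(\<integral>\<theta>. cis (real k * \<theta>) \<partial>\<nu>) = moment g k"
begin

lemma integrable_bounded:
  fixes f :: "real \<Rightarrow> 'b::{banach, second_countable_topology}"
  assumes "f \<in> borel_measurable borel" "\<And>\<theta>. norm (f \<theta>) \<le> C"
  shows "integrable \<nu> f"
  by (rule integrable_const_bound[of _ C]) (use assms in auto)

text \<open>For \<open>k \<le> j\<close> common powers cancel on both sides and a moment remains;
  the other case follows by conjugation.\<close>

lemma has_bochner_integral_cinner_U_pow: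
  "has_bochner_integral \<nu> (\<lambda>\<theta>. cis (j * \<theta>) * cnj (cis (k * \<theta>))) (cinner ((U ^^ j) g) ((U ^^ k) g))"
proof -
  have le: "has_bochner_integral \<nu> (\<lambda>\<theta>. cis (j * \<theta>) * cnj (cis (k * \<theta>))) (cinner ((U ^^ j) g) ((U ^^ k) g))"
    if "k \<le> j" for j k :: nat
  proof -
    have "has_bochner_integral \<nu> (\<lambda>\<theta>. cis (real (j - k) * \<theta>)) (moment g (j - k))"
      unfolding has_bochner_integral_iff moment_eq
      by (intro conjI refl integrable_bounded[where C = 1]) auto
    moreover have "cis (real (j - k) * \<theta>) = cis (j * \<theta>) * cnj (cis (k * \<theta>))" for \<theta> :: real
      using that by (simp add: cis_cnj cis_mult of_nat_diff algebra_simps)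
    moreover have "moment g (j - k) = cinner ((U ^^ j) g) ((U ^^ k) g)"
      using cinner_U_pow_add[of "j - k" k g] that by simp
    ultimately show ?thesis by simp
  qed
  show ?thesis
  proof (cases "k \<le> j")
    case False
    then have "has_bochner_integral \<nu> (\<lambda>\<theta>. cis (k * \<theta>) * cnj (cis (j * \<theta>))) (cinner ((U ^^ k) g) ((U ^^ j) g))"
      by (intro le) simp
    from has_bochner_integral_cnj[OF this] show ?thesis
      by (simp add: mult.commute cinner_commute[of "(U ^^ j) g"])
  qed (rule le)
qed

text \<open>Sending \<open>(U ^^ k) g\<close> to the character \<open>cis (k * \<theta>)\<close> is
  isometric on finite sums, so L2 estimates become estimates of vectors and conversely.\<close>

lemma norm_sum_U_pow:
  fixes n :: nat
  shows "(norm (\<Sum>k<n. a k *\<^sub>C (U ^^ k) g))\<^sup>2 = (\<integral>\<theta>. (cmod (\<Sum>k<n. a k * cis (real k * \<theta>)))\<^sup>2 \<partial>\<nu>)"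
proof -
  have "has_bochner_integral \<nu>
     (\<lambda>\<theta>. \<Sum>j<n. \<Sum>k<n. a j * cnj (a k) * (cis (j * \<theta>) * cnj (cis (k * \<theta>))))
     (\<Sum>j<n. \<Sum>k<n. a j * cnj (a k) * cinner ((U ^^ j) g) ((U ^^ k) g))"
    by (intro has_bochner_integral_sum has_bochner_integral_mult_right
        has_bochner_integral_cinner_U_pow)
  moreover have "(\<Sum>j<n. \<Sum>k<n. a j * cnj (a k) * (cis (j * \<theta>) * cnj (cis (k * \<theta>))))
     = complex_of_real ((cmod (\<Sum>k<n. a k * cis (k * \<theta>)))\<^sup>2)" for \<theta> :: real
    by (simp only: complex_norm_square cnj_sum sum_product) (simp add: mult_ac)
  moreover have "(\<Sum>j<n. \<Sum>k<n. a j * cnj (a k) * cinner ((U ^^ j) g) ((U ^^ k) g))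
     = complex_of_real ((norm (\<Sum>k<n. a k *\<^sub>C (U ^^ k) g))\<^sup>2)"
    by (simp only: cinner_self[symmetric] cinner_sum_right cinner_sum_left cinner_scaleC_left
        cinner_scaleC_right sum_distrib_left)
      (subst sum.swap, simp add: mult_ac)
  ultimately have "has_bochner_integral \<nu>
     (\<lambda>\<theta>. complex_of_real ((cmod (\<Sum>k<n. a k * cis (k * \<theta>)))\<^sup>2))
     (complex_of_real ((norm (\<Sum>k<n. a k *\<^sub>C (U ^^ k) g))\<^sup>2))"
    by simp
  from has_bochner_integral_Re[OF this] show ?thesis
    by (simp add: has_bochner_integral_iff)
qed

lemma integrable_trig_poly:
  "integrable \<nu> (\<lambda>\<theta>. (cmod (\<Sum>k<n. a k * cis (real k * \<theta>)))\<^sup>2)"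
proof (rule integrable_bounded)
  fix \<theta>
  have "cmod (\<Sum>k<n. a k * cis (real k * \<theta>)) \<le> (\<Sum>k<n. cmod (a k))"
    by (rule order_trans[OF norm_sum]) (simp add: norm_mult)
  then show "norm ((cmod (\<Sum>k<n. a k * cis (real k * \<theta>)))\<^sup>2) \<le> (\<Sum>k<n. cmod (a k))\<^sup>2"
    by (simp add: power_mono)
qed measurable

text \<open>Averages of the characters equal 1 wherever \<open>cis \<theta> = 1\<close>, so the mass
  of this set is at most the squared norm of an ergodic mean of \<open>g\<close>.\<close>

lemma AE_cis_neq_1:
  assumes dense: "closure (range (\<lambda>x. U x - x)) = UNIV"
  shows "AE \<theta> in \<nu>. cis \<theta> \<noteq> 1"
proof -
  have [measurable]: "{\<theta>. cis \<theta> = 1} \<in> sets borel" by measurable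
  have le: "prob {\<theta>. cis \<theta> = 1} \<le> (norm ((1 / real N) *\<^sub>R (\<Sum>k<N. (U ^^ k) g)))\<^sup>2" if "N > 0" for N
  proof -
    have "prob {\<theta>. cis \<theta> = 1} = (\<integral>\<theta>. indicator {\<theta>. cis \<theta> = 1} \<theta> \<partial>\<nu>)" by simp
    also have "\<dots> \<le> (\<integral>\<theta>. (cmod (\<Sum>k<N. of_real (1 / real N) * cis (k * \<theta>)))\<^sup>2 \<partial>\<nu>)"
    proof (rule integral_mono[OF _ integrable_trig_poly])
      fix \<theta> :: real
      have "cis (real k * \<theta>) = 1" if "cis \<theta> = 1" for k :: nat
        using Complex.DeMoivre[of \<theta> k] that by simp
      then show "indicator {\<theta>. cis \<theta> = 1} \<theta> \<le> (cmod (\<Sum>k<N. of_real (1 / real N) * cis (k * \<theta>)))\<^sup>2"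
        using \<open>N > 0\<close> by (auto simp: indicator_def)
    qed (auto intro!: integrable_real_indicator simp: emeasure_eq_measure)
    also have "\<dots> = (norm (\<Sum>k<N. of_real (1 / real N) *\<^sub>C (U ^^ k) g))\<^sup>2"
      by (rule norm_sum_U_pow[symmetric])
    finally show ?thesis by (simp only: scaleR_eq_scaleC[symmetric] scaleR_sum_right)
  qed
  have "(\<lambda>N. (norm ((1 / real N) *\<^sub>R (\<Sum>k<N. (U ^^ k) g)))\<^sup>2) \<longlonglongrightarrow> (norm (0::'a))\<^sup>2"
    by (intro tendsto_intros mean_ergodic dense)
  then have "prob {\<theta>. cis \<theta> = 1} \<le> (norm (0::'a))\<^sup>2"
    by (rule tendsto_lowerbound[OF _ eventually_mono[OF eventually_gt_at_top[of 0] le]]) simp_all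
  then have "emeasure \<nu> {\<theta>. cis \<theta> = 1} = 0"
    by (simp add: emeasure_eq_measure measure_le_0_iff)
  then show ?thesis
    by (intro AE_I[of _ _ "{\<theta>. cis \<theta> = 1}"]) auto
qed

text \<open>If the integral were finite, the polynomials \<open>\<Sum>k<N. (1 - k/N) e\<^sup>k\<close> would converge
  to \<open>1 / (1 - e)\<close> in \<open>L\<^sup>2(\<nu>)\<close>, which transfers to a solution \<open>f\<close> of
  \<open>f - U f = g\<close>.\<close>

lemma nn_integral_inverse_infinite:
  assumes dense: "closure (range (\<lambda>x. U x - x)) = UNIV"
    and g: "g \<notin> range (\<lambda>x. U x - x)"
  shows "(\<integral>\<^sup>+\<theta>. ennreal (1 / (cmod (1 - cis \<theta>))\<^sup>2) \<partial>\<nu>) = \<infinity>"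
proof (rule ccontr)
  assume fin: "\<not> ?thesis"
  define q where "q \<theta> = 1 / (1 - cis \<theta>)" for \<theta>
  \<comment> \<open>Cesaro weights. Truncated subtraction makes them 0 from \<open>k = N\<close> on,
    which later allows padding two sums to a common length \<open>L\<close>.\<close>
  define a where "a N k = complex_of_real (real (N - k) / N)" for N k
  define p where "p N \<theta> = (\<Sum>k<N. a N k * cis (real k * \<theta>))" for N \<theta>
  define f where "f N = (\<Sum>k<N. a N k *\<^sub>C (U ^^ k) g)" for N
  have [measurable]: "q \<in> borel_measurable borel" "p N \<in> borel_measurable borel" for N
    unfolding q_def p_def by measurable
  have int_q: "integrable \<nu> (\<lambda>\<theta>. (cmod (q \<theta>))\<^sup>2)"
    using fin by (intro integrableI_nonneg)
      (auto simp: q_def norm_divide power_divide less_top)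
  \<comment> \<open>The first bound supplies the majorant for dominated convergence, the second the
    pointwise limit. Both come from
    \<open>p N \<theta> - q \<theta> = - (q \<theta> * s / N)\<close>, with \<open>s\<close> bounded
    by \<open>N\<close> or, as a geometric sum, by \<open>2 * cmod (q \<theta>)\<close>.\<close>
  have pq: "cmod (p N \<theta> - q \<theta>) \<le> cmod (q \<theta>)" "cmod (p N \<theta> - q \<theta>) \<le> 2 * (cmod (q \<theta>))\<^sup>2 / N"
    if N: "N > 0" and e: "cis \<theta> \<noteq> 1" for N \<theta>
  proof -
    define s where "s = (\<Sum>k<N. cis \<theta> ^ Suc k)"
    have "(1 - cis \<theta>) * p N \<theta> = (\<Sum>k<N. real (N - k) *\<^sub>R (cis \<theta> ^ k - cis \<theta> ^ Suc k)) / N"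
      unfolding p_def a_def Complex.DeMoivre[symmetric] sum_distrib_left sum_divide_distrib
      by (intro sum.cong refl) (simp add: scaleR_conv_of_real field_simps)
    also have "\<dots> = (N - s) / N"
      unfolding weighted_telescope_sum[of N "\<lambda>k. cis \<theta> ^ k"] s_def by (simp add: scaleR_conv_of_real)
    finally have "(1 - cis \<theta>) * p N \<theta> = 1 - s / N"
      using N by (simp add: diff_divide_distrib)
    then have "p N \<theta> = (1 - s / N) / (1 - cis \<theta>)"
      using e by (simp add: eq_divide_eq mult.commute)
    then have eq: "p N \<theta> - q \<theta> = - (q \<theta> * s / N)"
      by (simp add: q_def diff_divide_distrib)
    have "cmod s \<le> N"
      unfolding s_def by (rule order_trans[OF norm_sum]) (simp add: norm_mult norm_power)
    then have "cmod s / N \<le> 1" using N by simp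
    then show "cmod (p N \<theta> - q \<theta>) \<le> cmod (q \<theta>)"
      unfolding eq using mult_left_mono[of "cmod s / N" 1 "cmod (q \<theta>)"]
      by (simp add: norm_mult norm_divide)
    have "s = cis \<theta> * ((1 - cis \<theta> ^ N) * q \<theta>)"
      unfolding s_def using e
      by (simp add: q_def sum_gp_strict flip: sum_distrib_left)
    moreover have "cmod (1 - cis \<theta> ^ N) \<le> 2"
      using norm_triangle_ineq4[of 1 "cis \<theta> ^ N"] by (simp add: norm_power)
    ultimately have "cmod s \<le> 2 * cmod (q \<theta>)" by (simp add: norm_mult mult_right_mono)
    then show "cmod (p N \<theta> - q \<theta>) \<le> 2 * (cmod (q \<theta>))\<^sup>2 / N"
      unfolding eq using N mult_left_mono[of "cmod s" "2 * cmod (q \<theta>)" "cmod (q \<theta>)"]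
      by (simp add: norm_mult norm_divide divide_right_mono power2_eq_square mult_ac)
  qed
  define D where "D N = (\<integral>\<theta>. (cmod (p (Suc N) \<theta> - q \<theta>))\<^sup>2 \<partial>\<nu>)" for N
  have AE_bound: "AE \<theta> in \<nu>. norm ((cmod (p (Suc N) \<theta> - q \<theta>))\<^sup>2) \<le> (cmod (q \<theta>))\<^sup>2" for N
    using AE_cis_neq_1[OF dense] by eventually_elim (simp add: pq(1) power_mono)
  have int_D: "integrable \<nu> (\<lambda>\<theta>. (cmod (p (Suc N) \<theta> - q \<theta>))\<^sup>2)" for N
    by (rule Bochner_Integration.integrable_bound[OF int_q]) (use AE_bound in auto)
  have "D \<longlonglongrightarrow> (\<integral>\<theta>. 0 \<partial>\<nu>)"
    unfolding D_def
  proof (rule integral_dominated_convergence[OF _ _ int_q _ AE_bound])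
    show "AE \<theta> in \<nu>. (\<lambda>N. (cmod (p (Suc N) \<theta> - q \<theta>))\<^sup>2) \<longlonglongrightarrow> 0"
      using AE_cis_neq_1[OF dense]
    proof eventually_elim
      case (elim \<theta>)
      have "(\<lambda>N. 2 * (cmod (q \<theta>))\<^sup>2 * inverse (real (Suc N))) \<longlonglongrightarrow> 0"
        by (intro tendsto_mult_right_zero LIMSEQ_inverse_real_of_nat)
      then have "(\<lambda>N. cmod (p (Suc N) \<theta> - q \<theta>)) \<longlonglongrightarrow> 0"
        by (rule Lim_null_comparison[rotated])
          (use pq(2)[OF _ elim] in \<open>simp add: divide_inverse del: of_nat_Suc\<close>)
      then have "(\<lambda>N. (cmod (p (Suc N) \<theta> - q \<theta>))\<^sup>2) \<longlonglongrightarrow> 0\<^sup>2" by (rule tendsto_power)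
      then show ?case by simp
    qed
  qed auto
  then have D0: "D \<longlonglongrightarrow> 0" by simp
  \<comment> \<open>Both polynomials are compared with \<open>q\<close> in L2, and
    \<open>norm_sum_U_pow\<close> carries the estimate over to the vectors.\<close>
  have diff: "(norm (f (Suc N) - f (Suc M)))\<^sup>2 \<le> 2 * D N + 2 * D M" for N M
  proof -
    define L where "L = max (Suc N) (Suc M)"
    define b where "b k = a (Suc N) k - a (Suc M) k" for k
    have ext: "f K = (\<Sum>k<L. a K k *\<^sub>C (U ^^ k) g)" "p K \<theta> = (\<Sum>k<L. a K k * cis (real k * \<theta>))"
      if "K \<le> L" for K \<theta>
    proof -
      have "a K k = 0" if "K \<le> k" for k using that by (simp add: a_def)
      then show "f K = (\<Sum>k<L. a K k *\<^sub>C (U ^^ k) g)" "p K \<theta> = (\<Sum>k<L. a K k * cis (real k * \<theta>))"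
        unfolding f_def p_def using that by (intro sum.mono_neutral_left; simp)+
    qed
    have LN: "Suc N \<le> L" "Suc M \<le> L" by (auto simp: L_def)
    have fd: "f (Suc N) - f (Suc M) = (\<Sum>k<L. b k *\<^sub>C (U ^^ k) g)"
      unfolding ext(1)[OF LN(1)] ext(1)[OF LN(2)] b_def
      by (simp only: sum_subtractf[symmetric] complex_vector.scale_left_diff_distrib)
    have pd: "p (Suc N) \<theta> - p (Suc M) \<theta> = (\<Sum>k<L. b k * cis (real k * \<theta>))" for \<theta>
      unfolding ext(2)[OF LN(1)] ext(2)[OF LN(2)] b_def
      by (simp only: sum_subtractf[symmetric] left_diff_distrib)
    have "(norm (f (Suc N) - f (Suc M)))\<^sup>2 = (\<integral>\<theta>. (cmod (p (Suc N) \<theta> - p (Suc M) \<theta>))\<^sup>2 \<partial>\<nu>)"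
      unfolding fd pd by (rule norm_sum_U_pow)
    also have "\<dots> \<le> (\<integral>\<theta>. 2 * (cmod (p (Suc N) \<theta> - q \<theta>))\<^sup>2 + 2 * (cmod (p (Suc M) \<theta> - q \<theta>))\<^sup>2 \<partial>\<nu>)"
    proof (rule integral_mono)
      show "integrable \<nu> (\<lambda>\<theta>. (cmod (p (Suc N) \<theta> - p (Suc M) \<theta>))\<^sup>2)"
        unfolding pd by (rule integrable_trig_poly)
      show "(cmod (p (Suc N) \<theta> - p (Suc M) \<theta>))\<^sup>2
          \<le> 2 * (cmod (p (Suc N) \<theta> - q \<theta>))\<^sup>2 + 2 * (cmod (p (Suc M) \<theta> - q \<theta>))\<^sup>2" for \<theta>
      proof -
        let ?x = "cmod (p (Suc N) \<theta> - q \<theta>)" and ?y = "cmod (p (Suc M) \<theta> - q \<theta>)"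
        have "cmod (p (Suc N) \<theta> - p (Suc M) \<theta>) \<le> ?x + ?y"
          using norm_triangle_ineq4[of "p (Suc N) \<theta> - q \<theta>" "p (Suc M) \<theta> - q \<theta>"] by simp
        then have "(cmod (p (Suc N) \<theta> - p (Suc M) \<theta>))\<^sup>2 \<le> (?x + ?y)\<^sup>2"
          by (rule power_mono) simp
        moreover have "(?x + ?y)\<^sup>2 \<le> 2 * ?x\<^sup>2 + 2 * ?y\<^sup>2"
          using zero_le_power2[of "?x - ?y"] by (simp add: power2_eq_square algebra_simps)
        ultimately show ?thesis by linarith
      qed
    qed (use int_D in auto)
    also have "\<dots> = 2 * D N + 2 * D M" using int_D by (simp add: D_def)
    finally show ?thesis .
  qed
  have "Cauchy (\<lambda>N. f (Suc N))"
  proof (rule CauchyI)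
    fix e :: real assume "e > 0"
    then have "e\<^sup>2 / 4 > 0" by simp
    then obtain K where K: "\<And>n. n \<ge> K \<Longrightarrow> norm (D n - 0) < e\<^sup>2 / 4"
      using LIMSEQ_D[OF D0] by metis
    have "norm (f (Suc n) - f (Suc m)) < e" if "n \<ge> K" "m \<ge> K" for n m
    proof -
      have "(norm (f (Suc n) - f (Suc m)))\<^sup>2 < e\<^sup>2"
        using diff[of n m] K[OF that(1)] K[OF that(2)] unfolding diff_zero real_norm_def abs_less_iff
        by argo
      then show ?thesis using \<open>e > 0\<close> by (auto intro: power2_less_imp_less)
    qed
    then show "\<exists>K. \<forall>n\<ge>K. \<forall>m\<ge>K. norm (f (Suc n) - f (Suc m)) < e" by blast
  qed
  then obtain f0 where f0: "(\<lambda>N. f (Suc N)) \<longlonglongrightarrow> f0"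
    using Cauchy_convergent convergent_def by blast
  \<comment> \<open>The vector counterpart of the formula for
    \<open>(1 - cis \<theta>) * p N \<theta>\<close>: the subtracted average is now an ergodic mean
    of \<open>U g\<close>, which tends to 0.\<close>
  have fU: "f N - U (f N) = g - (1 / real N) *\<^sub>R (\<Sum>k<N. (U ^^ k) (U g))" if "N > 0" for N
  proof -
    have "f N = (\<Sum>k<N. (real (N - k) / N) *\<^sub>R (U ^^ k) g)"
      by (simp add: f_def a_def scaleR_eq_scaleC)
    moreover from this have "U (f N) = (\<Sum>k<N. (real (N - k) / N) *\<^sub>R (U ^^ Suc k) g)"
      by (simp add: linear_sum[OF bounded_linear.linear[OF bounded_linear_U]]
          linear_scale[OF bounded_linear.linear[OF bounded_linear_U]])
    ultimately have "f N - U (f N) = (\<Sum>k<N. (real (N - k) / N) *\<^sub>R ((U ^^ k) g - (U ^^ Suc k) g))"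
      by (simp only: sum_subtractf[symmetric] scaleR_right_diff_distrib)
    also have "\<dots> = (1 / real N) *\<^sub>R (\<Sum>k<N. real (N - k) *\<^sub>R ((U ^^ k) g - (U ^^ Suc k) g))"
      by (simp add: scaleR_sum_right)
    also have "\<dots> = (1 / real N) *\<^sub>R (real N *\<^sub>R g - (\<Sum>k<N. (U ^^ Suc k) g))"
      by (simp only: weighted_telescope_sum[of N "\<lambda>k. (U ^^ k) g"]) simp
    finally show ?thesis
      using that by (simp add: scaleR_right_diff_distrib funpow_swap1)
  qed
  have "(\<lambda>N. g - (1 / real (Suc N)) *\<^sub>R (\<Sum>k<Suc N. (U ^^ k) (U g))) \<longlonglongrightarrow> g - 0"
    by (intro tendsto_diff tendsto_const LIMSEQ_Suc[OF mean_ergodic[OF dense]])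
  then have "(\<lambda>N. f (Suc N) - U (f (Suc N))) \<longlonglongrightarrow> g" by (simp add: fU del: sum.lessThan_Suc of_nat_Suc)
  moreover have "(\<lambda>N. f (Suc N) - U (f (Suc N))) \<longlonglongrightarrow> f0 - U f0"
    by (intro tendsto_diff f0 bounded_linear.tendsto[OF bounded_linear_U])
  ultimately have "g = f0 - U f0" using LIMSEQ_unique by blast
  also have "\<dots> = U (- f0) - (- f0)" using U_diff[of 0 f0] U_diff[of 0 0] by simp
  finally show False using g by blast
qed

end

section \<open>Resolvents of self-adjoint operators and the Donoghue class\<close>

text \<open>The scalar Cayley transform in half-angle form: \<open>cot (\<theta> / 2)\<close> is the
  real point that corresponds to \<open>cis \<theta>\<close> as \<open>S\<close> does to its Cayley
  transform.\<close>

lemma cis_eq_cot_quotient: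
  assumes "cis \<theta> \<noteq> 1"
  shows "cis \<theta> = (of_real (cot (\<theta> / 2)) + \<i>) / (of_real (cot (\<theta> / 2)) - \<i>)"
proof -
  let ?s = "sin (\<theta> / 2)" and ?c = "cos (\<theta> / 2)"
  have half: "cis \<theta> = cis (\<theta> / 2) * cis (\<theta> / 2)" by (simp add: cis_mult)
  have "?s \<noteq> 0"
  proof
    assume s: "?s = 0"
    then have "?c * ?c = 1" using sin_cos_squared_add[of "\<theta> / 2"] by (simp add: power2_eq_square)
    then have "cis (\<theta> / 2) * cis (\<theta> / 2) = 1" using s by (simp add: complex_eq_iff)
    then show False using assms half by simp
  qed
  then have "of_real (cot (\<theta> / 2)) + \<i> = cis (\<theta> / 2) / ?s"
    "of_real (cot (\<theta> / 2)) - \<i> = inverse (cis (\<theta> / 2)) / ?s"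
    by (simp_all add: complex_eq_iff cot_def cis_inverse)
  then show ?thesis using \<open>?s \<noteq> 0\<close> by (simp add: cis_divide)
qed

lemma of_real_minus_neq_0:
  assumes "Im z > 0"
  shows "of_real t - z \<noteq> 0" "of_real t + \<i> \<noteq> 0" "of_real t - \<i> \<noteq> 0"
  using assms by (auto simp: complex_eq_iff)

text \<open>The right side is the Donoghue kernel \<open>1/(t - z) - t/(1 + t^2)\<close> multiplied
  by \<open>1 + t^2\<close>. The left side is what the resolvent formula yields when
  \<open>U\<close> is replaced by the scalar \<open>e\<close>.\<close>

lemma donoghue_kernel_cayley:
  assumes "Im z > 0" and e: "e = (of_real t + \<i>) / (of_real t - \<i>)"
  shows "z + (z - \<i>) * ((e - 1) / (1 - disc_coord z * e)) = (1 + of_real t * z) / (of_real t - z)"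
proof -
  note nz = of_real_minus_neq_0[OF assms(1), of t] cmod_disc_coord_less_1(1)[OF assms(1)]
  have "e - 1 = 2 * \<i> / (of_real t - \<i>)"
    using nz by (simp add: e field_simps)
  moreover have "1 - disc_coord z * e = (2 * \<i> * (of_real t - z)) / ((of_real t - \<i>) * (z + \<i>))"
    using nz by (simp add: e divide_simps) (simp add: algebra_simps)
  ultimately have "(e - 1) / (1 - disc_coord z * e) = (z + \<i>) / (of_real t - z)"
    using nz by simp
  moreover have "z + (z - \<i>) * ((z + \<i>) / (of_real t - z)) = (1 + of_real t * z) / (of_real t - z)"
    using nz by (simp add: field_simps)
  ultimately show ?thesis by (simp only:)
qed

lemma Im_donoghue_kernel:
  assumes "Im z > 0"
  shows "Im ((1 + of_real t * z) / (of_real t - z)) > 0"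
proof -
  let ?n = "(cmod (of_real t - z))\<^sup>2"
  have n: "?n > 0" using of_real_minus_neq_0(1)[OF assms, of t] by simp
  have "Im ((1 + of_real t * z) / (of_real t - z)) = Im z * (1 + t\<^sup>2) / ?n"
    unfolding complex_div_cnj[of "1 + of_real t * z"]
    by (simp add: Im_divide_of_real flip: of_real_power) (simp add: power2_eq_square algebra_simps)
  then show ?thesis using n assms by (simp add: add_pos_nonneg)
qed

section \<open>Power series in the disc coordinate\<close>

context hilbert_isometry
begin

lemma neumann_series_moment_sums:
  assumes "cmod w < 1"
  shows "(\<lambda>k. w ^ k * (moment g (Suc k) - moment g k)) sums
           cinner (U (neumann_series w g) - neumann_series w g) g"
proof -
  have "(\<lambda>k. cinner (U (w ^ k *\<^sub>C (U ^^ k) g) - w ^ k *\<^sub>C (U ^^ k) g) g) sums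
          cinner (U (neumann_series w g) - neumann_series w g) g"
    by (intro bounded_linear.sums[OF bounded_linear_cinner_left] sums_diff
        bounded_linear.sums[OF bounded_linear_U] neumann_series_sums assms)
  then show ?thesis
    by (simp add: moment_def U_scaleC cinner_simps right_diff_distrib)
qed

end

text \<open>Both sides have the same expansion in powers of \<open>w\<close>, since the characters
  integrate to the moments. The geometric bound \<open>2 * cmod w ^ k\<close> justifies the
  interchange of sum and integral.\<close>

lemma (in spectral_measure) cinner_neumann_series:
  assumes w: "cmod w < 1"
  shows "has_bochner_integral \<nu> (\<lambda>\<theta>. (cis \<theta> - 1) / (1 - w * cis \<theta>))
           (cinner (U (neumann_series w g) - neumann_series w g) g)"
proof -
  define f where "f k \<theta> = w ^ k * (cis (real (Suc k) * \<theta>) - cis (real k * \<theta>))" for k and \<theta> :: real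
  have [measurable]: "f k \<in> borel_measurable borel" for k unfolding f_def by measurable
  have f_le: "norm (f k \<theta>) \<le> 2 * cmod w ^ k" for k \<theta>
  proof -
    have "cmod (cis (real (Suc k) * \<theta>) - cis (real k * \<theta>)) \<le> 2"
      using norm_triangle_ineq4[of "cis (real (Suc k) * \<theta>)" "cis (real k * \<theta>)"] by simp
    then show ?thesis
      unfolding f_def norm_mult norm_power by (metis mult.commute mult_left_mono norm_ge_zero zero_le_power)
  qed
  have int: "integrable \<nu> (f k)" for k by (rule integrable_bounded[OF _ f_le]) measurable
  have geo: "summable (\<lambda>k. 2 * cmod w ^ k)" using w by (intro summable_mult summable_geometric) simp
  have sm: "summable (\<lambda>k. norm (f k \<theta>))" for \<theta>
    by (rule summable_comparison_test'[OF geo, of 0]) (use f_le in auto)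
  have smi: "summable (\<lambda>k. \<integral>\<theta>. norm (f k \<theta>) \<partial>\<nu>)"
  proof (rule summable_comparison_test'[OF geo, of 0])
    fix k
    have "(\<integral>\<theta>. norm (f k \<theta>) \<partial>\<nu>) \<le> (\<integral>\<theta>. 2 * cmod w ^ k \<partial>\<nu>)"
      using int f_le by (intro integral_mono) auto
    then show "norm (\<integral>\<theta>. norm (f k \<theta>) \<partial>\<nu>) \<le> 2 * cmod w ^ k"
      using prob_space[unfolded space_eq_univ] by simp
  qed
  have suminf_f: "(\<Sum>k. f k \<theta>) = (cis \<theta> - 1) / (1 - w * cis \<theta>)" for \<theta>
  proof -
    have "(\<lambda>k. (w * cis \<theta>) ^ k * (cis \<theta> - 1)) sums (1 / (1 - w * cis \<theta>) * (cis \<theta> - 1))"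
      using w by (intro sums_mult2 geometric_sums) (simp add: norm_mult)
    moreover have "(w * cis \<theta>) ^ k * (cis \<theta> - 1) = f k \<theta>" for k
      unfolding f_def Complex.DeMoivre[symmetric] by (simp add: power_mult_distrib algebra_simps)
    ultimately show ?thesis by (simp add: sums_iff)
  qed
  have int_f: "(\<integral>\<theta>. f k \<theta> \<partial>\<nu>) = w ^ k * (moment g (Suc k) - moment g k)" for k
  proof -
    have "integrable \<nu> (\<lambda>\<theta>. cis (real k * \<theta>))" for k
      by (rule integrable_bounded[of _ 1]) auto
    then show ?thesis by (simp add: f_def moment_eq del: of_nat_Suc)
  qed
  have "(\<lambda>k. \<integral>\<theta>. f k \<theta> \<partial>\<nu>) sums (\<integral>\<theta>. (\<Sum>k. f k \<theta>) \<partial>\<nu>)"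
    using int sm smi by (intro sums_integral) auto
  then have "(\<integral>\<theta>. (\<Sum>k. f k \<theta>) \<partial>\<nu>) = cinner (U (neumann_series w g) - neumann_series w g) g"
    unfolding int_f using neumann_series_moment_sums[OF w, of g] sums_unique2 by blast
  moreover have "integrable \<nu> (\<lambda>\<theta>. \<Sum>k. f k \<theta>)"
    using int sm smi by (intro integrable_suminf) auto
  ultimately show ?thesis by (simp add: has_bochner_integral_iff suminf_f)
qed

lemma holomorphic_on_disc_power_series:
  assumes "\<And>w. cmod w < 1 \<Longrightarrow> summable (\<lambda>k. a k * w ^ k)"
  shows "(\<lambda>w. \<Sum>k. a k * w ^ k) holomorphic_on ball 0 1"
proof -
  have "(\<lambda>w. \<Sum>k. a k * w ^ k) field_differentiable at w" if "cmod w < 1" for w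
  proof -
    \<comment> \<open>A point of modulus halfway between \<open>cmod w\<close> and 1: convergence
      there permits termwise differentiation at \<open>w\<close>.\<close>
    define K :: complex where "K = of_real ((1 + cmod w) / 2)"
    have K: "cmod K = (1 + cmod w) / 2"
      unfolding K_def norm_of_real by simp
    then have "summable (\<lambda>k. a k * K ^ k)" using that by (intro assms) simp
    then have "DERIV (\<lambda>w. \<Sum>k. a k * w ^ k) w :> (\<Sum>k. diffs a k * w ^ k)"
      by (rule termdiffs_strong) (use that K in simp)
    then show ?thesis by (auto simp: field_differentiable_def)
  qed
  then show ?thesis
    unfolding holomorphic_on_def by (simp add: field_differentiable_at_within)
qed

text \<open>Here \<open>r\<close> is \<open>(S - z)^(-1) g\<close>, so
  \<open>F z = z + (z^2 + 1) (r, g)\<close>. This is the integral of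
  \<open>z + (z^2 + 1)/(t - z) = (1 + t z)/(t - z)\<close> against the spectral measure of
  \<open>g\<close>; moving a factor \<open>1 + t^2\<close> from the kernel to the measure gives the
  Donoghue form.\<close>

theorem selfadjoint_resolvent_in_donoghue_class:
  fixes S :: "('a::complex_hilbert \<times> 'a) set"
  assumes sa: "selfadjoint S" and g: "norm g = 1" "g \<notin> Domain S"
    and F: "\<And>z r. Im z > 0 \<Longrightarrow> (r, g + z *\<^sub>C r) \<in> S \<Longrightarrow>
              F z = - \<i> + (z + \<i>) * cinner (g + (z - \<i>) *\<^sub>C r) g"
  shows "F \<in> donoghue_class"
proof -
  define U where "U = cayley S"
  interpret hilbert_isometry U unfolding U_def by (rule hilbert_isometry_cayley[OF sa])
  obtain \<nu> where "real_distribution \<nu>" "\<And>k. (\<integral>\<theta>. cis (real k * \<theta>) \<partial>\<nu>) = moment g k"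
    using spectral_measure_exists[OF g(1)] by blast
  then interpret spectral_measure U g \<nu>
    by (auto simp: spectral_measure_def spectral_measure_axioms_def hilbert_isometry_axioms)
  have dom: "Domain S = range (\<lambda>x. U x - x)"
    unfolding U_def by (rule Domain_eq_range_cayley_minus_id[OF sa])
  have dense: "closure (range (\<lambda>x. U x - x)) = UNIV"
    using selfadjoint_imp_dense[OF sa] by (simp add: dom)
  define t where "t \<theta> = cot (\<theta> / 2)" for \<theta> :: real
  have [measurable]: "t \<in> borel_measurable borel" unfolding t_def cot_def by measurable
  define h where "h z s = (1 + of_real s * z) / (of_real s - z)" for z :: complex and s :: real
  have [measurable]: "h z \<in> borel_measurable borel" for z unfolding h_def by measurable
  \<comment> \<open>Where \<open>cis \<theta> = 1\<close> the division in \<open>cot\<close>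
    defaults to 0 and the identity fails, but this set is null.\<close>
  have AE_cis: "AE \<theta> in \<nu>. cis \<theta> = (of_real (t \<theta>) + \<i>) / (of_real (t \<theta>) - \<i>)"
    using AE_cis_neq_1[OF dense] by eventually_elim (simp add: cis_eq_cot_quotient t_def)
  define G where "G w = cinner (U (neumann_series w g) - neumann_series w g) g" for w
  have F_eq: "F z = z + (z - \<i>) * G (disc_coord z)" if z: "Im z > 0" for z
  proof -
    define n where "n = neumann_series (disc_coord z) g"
    let ?x = "(1 / (z + \<i>)) *\<^sub>C n"
    have "(U ?x - ?x, g + z *\<^sub>C (U ?x - ?x)) \<in> S"
      unfolding U_def n_def by (rule selfadjoint_resolvent[OF sa z])
    from F[OF z this]
    have "F z = - \<i> + (z + \<i>) * (1 + (z - \<i>) * cinner (U ?x - ?x) g)"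
      by (simp add: cinner_add_left cinner_scaleC_left cinner_self g(1))
    also have "cinner (U ?x - ?x) g = G (disc_coord z) / (z + \<i>)"
      unfolding G_def n_def[symmetric]
      by (simp add: cinner_diff_left U_scaleC cinner_scaleC_left diff_divide_distrib)
    also have "- \<i> + (z + \<i>) * (1 + (z - \<i>) * (G (disc_coord z) / (z + \<i>))) = z + (z - \<i>) * G (disc_coord z)"
      using cmod_disc_coord_less_1(1)[OF z] by (simp add: distrib_left)
    finally show ?thesis .
  qed
  have F_int: "has_bochner_integral \<nu> (\<lambda>\<theta>. h z (t \<theta>)) (F z)" if z: "Im z > 0" for z
  proof -
    have "has_bochner_integral \<nu> (\<lambda>\<theta>. z + (z - \<i>) * ((cis \<theta> - 1) / (1 - disc_coord z * cis \<theta>))) (F z)"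
      unfolding F_eq[OF z] G_def
      by (intro has_bochner_integral_add has_bochner_integral_mult_right cinner_neumann_series
          cmod_disc_coord_less_1 z) (simp add: has_bochner_integral_iff prob_space[unfolded space_eq_univ])
    moreover have "AE \<theta> in \<nu>. z + (z - \<i>) * ((cis \<theta> - 1) / (1 - disc_coord z * cis \<theta>)) = h z (t \<theta>)"
      using AE_cis by eventually_elim (simp only: donoghue_kernel_cayley[OF z] h_def)
    ultimately show ?thesis
      by (subst (asm) has_bochner_integral_cong_AE) auto
  qed
  have "F holomorphic_on upper_half_plane"
  proof -
    have G_sums: "(\<lambda>k. (moment g (Suc k) - moment g k) * w ^ k) sums G w" if "cmod w < 1" for w
      using neumann_series_moment_sums[OF that, of g] by (simp add: G_def mult.commute)
    have "G holomorphic_on ball 0 1"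
    proof (rule holomorphic_transform)
      show "(\<lambda>w. \<Sum>k. (moment g (Suc k) - moment g k) * w ^ k) holomorphic_on ball 0 1"
        using G_sums sums_summable by (intro holomorphic_on_disc_power_series) blast
    qed (use G_sums in \<open>auto simp: sums_iff\<close>)
    moreover have "disc_coord holomorphic_on upper_half_plane"
      using cmod_disc_coord_less_1(1) by (intro holomorphic_intros) auto
    ultimately have "(G \<circ> disc_coord) holomorphic_on upper_half_plane"
      using cmod_disc_coord_less_1(2) by (intro holomorphic_on_compose_gen) auto
    then have "(\<lambda>z. z + (z - \<i>) * (G \<circ> disc_coord) z) holomorphic_on upper_half_plane"
      by (intro holomorphic_intros)
    then show ?thesis by (rule holomorphic_transform) (simp add: F_eq)
  qed
  moreover have "F ` upper_half_plane \<subseteq> upper_half_plane"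
  proof (intro image_subsetI CollectI)
    fix z assume "z \<in> upper_half_plane"
    then have z: "Im z > 0" by simp
    have Im: "has_bochner_integral \<nu> (\<lambda>\<theta>. Im (h z (t \<theta>))) (Im (F z))"
      by (rule has_bochner_integral_Im[OF F_int[OF z]])
    have pos: "Im (h z (t \<theta>)) > 0" for \<theta> unfolding h_def by (rule Im_donoghue_kernel[OF z])
    have "(\<integral>\<theta>. Im (h z (t \<theta>)) \<partial>\<nu>) \<ge> 0"
      using pos by (intro Bochner_Integration.integral_nonneg) (rule less_imp_le)
    then have "Im (F z) \<ge> 0" using Im by (simp add: has_bochner_integral_iff)
    \<comment> \<open>A nonnegative integrand with zero integral vanishes almost everywhere, which a
      strictly positive one cannot do under a probability measure.\<close>
    moreover have "Im (F z) \<noteq> 0"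
    proof
      assume "Im (F z) = 0"
      then have "AE \<theta> in \<nu>. Im (h z (t \<theta>)) = 0"
        using Im pos integral_nonneg_eq_0_iff_AE[of \<nu> "\<lambda>\<theta>. Im (h z (t \<theta>))"]
        by (simp add: has_bochner_integral_iff less_imp_le)
      then have "AE \<theta> in \<nu>. False" using pos by (simp add: less_imp_neq[THEN not_sym])
      then show False by simp
    qed
    ultimately show "Im (F z) > 0" by simp
  qed
  moreover have "\<exists>\<mu> :: real measure. sets \<mu> = sets borel \<and> emeasure \<mu> UNIV = \<infinity> \<and>
            (\<integral>\<^sup>+ t. ennreal (1 / (1 + t\<^sup>2)) \<partial>\<mu>) = 1 \<and>
            (\<forall>z \<in> upper_half_plane.
               F z = (\<integral>t. 1 / (complex_of_real t - z) - complex_of_real (t / (1 + t\<^sup>2)) \<partial>\<mu>))"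
  proof (intro exI conjI ballI)
    \<comment> \<open>The weight cancels \<open>1 / (1 + s^2)\<close>, so the normalization integral
      becomes the total mass of \<open>\<nu>\<close>.\<close>
    define \<mu> where "\<mu> = density (distr \<nu> borel t) (\<lambda>s. ennreal (1 + s\<^sup>2))"
    show "sets \<mu> = sets borel" by (simp add: \<mu>_def)
    have "emeasure \<mu> UNIV = (\<integral>\<^sup>+\<theta>. ennreal (1 + (t \<theta>)\<^sup>2) \<partial>\<nu>)"
      by (simp add: \<mu>_def emeasure_density nn_integral_distr)
    \<comment> \<open>Almost everywhere \<open>1 + t^2\<close> is 4 divided by the squared distance
      of \<open>cis \<theta>\<close> from 1, so the mass is four times the integral that diverges
      because \<open>g\<close> lies outside the domain.\<close>
    also have "\<dots> = (\<integral>\<^sup>+\<theta>. 4 * ennreal (1 / (cmod (1 - cis \<theta>))\<^sup>2) \<partial>\<nu>)"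
    proof (rule nn_integral_cong_AE)
      show "AE \<theta> in \<nu>. ennreal (1 + (t \<theta>)\<^sup>2) = 4 * ennreal (1 / (cmod (1 - cis \<theta>))\<^sup>2)"
        using AE_cis
      proof eventually_elim
        case (elim \<theta>)
        let ?t = "of_real (t \<theta>) :: complex"
        have nz: "?t - \<i> \<noteq> 0" by (auto simp: complex_eq_iff)
        then have "1 - cis \<theta> = - 2 * \<i> / (?t - \<i>)" by (simp add: elim field_simps)
        then have "(cmod (1 - cis \<theta>))\<^sup>2 = 4 / (cmod (?t - \<i>))\<^sup>2"
          by (simp add: norm_divide norm_mult power_divide)
        also have "(cmod (?t - \<i>))\<^sup>2 = 1 + (t \<theta>)\<^sup>2" by (simp add: cmod_power2)
        finally have "1 + (t \<theta>)\<^sup>2 = 4 * (1 / (cmod (1 - cis \<theta>))\<^sup>2)" by simp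
        then show ?case by (simp only: ennreal_mult') simp
      qed
    qed
    also have "\<dots> = \<infinity>"
      by (subst nn_integral_cmult)
        (use nn_integral_inverse_infinite[OF dense] g(2) in \<open>auto simp: dom ennreal_mult_top\<close>)
    finally show "emeasure \<mu> UNIV = \<infinity>" .
    have "(\<integral>\<^sup>+ s. ennreal (1 / (1 + s\<^sup>2)) \<partial>\<mu>) = (\<integral>\<^sup>+ s. 1 \<partial>distr \<nu> borel t)"
      unfolding \<mu>_def
    proof (subst nn_integral_density)
      show "(\<integral>\<^sup>+ s. ennreal (1 + s\<^sup>2) * ennreal (1 / (1 + s\<^sup>2)) \<partial>distr \<nu> borel t) = (\<integral>\<^sup>+ s. 1 \<partial>distr \<nu> borel t)"
      proof (rule nn_integral_cong)
        fix s :: real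
        have "1 + s\<^sup>2 > 0" by (simp add: add_pos_nonneg)
        then have "ennreal ((1 + s\<^sup>2) * (1 / (1 + s\<^sup>2))) = 1" by simp
        then show "ennreal (1 + s\<^sup>2) * ennreal (1 / (1 + s\<^sup>2)) = 1"
          by (subst ennreal_mult'[symmetric]) simp_all
      qed
    qed measurable
    also have "\<dots> = 1" by (simp add: emeasure_distr emeasure_space_1[unfolded space_eq_univ])
    finally show "(\<integral>\<^sup>+ s. ennreal (1 / (1 + s\<^sup>2)) \<partial>\<mu>) = 1" .
    fix z assume "z \<in> upper_half_plane"
    then have z: "Im z > 0" by simp
    have "(\<integral>s. 1 / (complex_of_real s - z) - complex_of_real (s / (1 + s\<^sup>2)) \<partial>\<mu>)
        = (\<integral>s. (1 + s\<^sup>2) *\<^sub>R (1 / (complex_of_real s - z) - complex_of_real (s / (1 + s\<^sup>2))) \<partial>distr \<nu> borel t)"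
      unfolding \<mu>_def by (subst integral_density) auto
    also have "\<dots> = (\<integral>s. h z s \<partial>distr \<nu> borel t)"
    proof (rule Bochner_Integration.integral_cong[OF refl])
      fix s :: real
      have "1 + s\<^sup>2 \<noteq> 0" by (smt (verit) zero_le_power2)
      then have "complex_of_real (1 + s\<^sup>2) \<noteq> 0" by (metis of_real_eq_0_iff)
      moreover have "complex_of_real s - z \<noteq> 0" by (rule of_real_minus_neq_0(1)[OF z])
      moreover have "n * (1 / d - a / n) = (n - a * d) / d" if "n \<noteq> 0" "d \<noteq> 0" for n d a :: complex
        using that by (simp add: field_simps)
      ultimately have "(1 + s\<^sup>2) *\<^sub>R (1 / (complex_of_real s - z) - complex_of_real (s / (1 + s\<^sup>2)))
          = (complex_of_real (1 + s\<^sup>2) - complex_of_real s * (complex_of_real s - z)) / (complex_of_real s - z)"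
        by (simp only: scaleR_conv_of_real of_real_divide)
      then show "(1 + s\<^sup>2) *\<^sub>R (1 / (complex_of_real s - z) - complex_of_real (s / (1 + s\<^sup>2))) = h z s"
        by (simp add: h_def power2_eq_square algebra_simps)
    qed
    also have "\<dots> = (\<integral>\<theta>. h z (t \<theta>) \<partial>\<nu>)" by (subst integral_distr) auto
    also have "\<dots> = F z" using F_int[OF z] by (simp add: has_bochner_integral_iff)
    finally show "F z = (\<integral>s. 1 / (complex_of_real s - z) - complex_of_real (s / (1 + s\<^sup>2)) \<partial>\<mu>)" ..
  qed
  ultimately show ?thesis by (simp add: donoghue_class_def)
qed

section \<open>L-systems\<close>

lemma complex_subspace_adj: "complex_vector.subspace (adj (A::('a::complex_hilbert \<times> 'a) set))"
proof (rule complex_vector.subspaceI)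
  show "0 \<in> adj A" by (simp add: zero_prod_def adj_iff)
  show "x + y \<in> adj A" if "x \<in> adj A" "y \<in> adj A" for x y
    using that by (cases x; cases y) (simp add: adj_iff cinner_add_right)
  show "c *\<^sub>C x \<in> adj A" if "x \<in> adj A" for c x
    using that by (cases x) (simp add: adj_iff cinner_scaleC_right scaleC_prod_def)
qed

lemma complex_dim_1_multiple:
  fixes V :: "'a::complex_hilbert set"
  assumes "complex_vector.dim V = 1" "f \<in> V" "f \<noteq> 0" "g \<in> V"
  obtains c where "g = c *\<^sub>C f"
proof -
  obtain B where B: "V \<subseteq> complex_vector.span B" "card B = 1"
    using complex_vector.basis_exists[of V] assms(1) by metis
  then obtain b where "B = {b}" by (auto simp: card_1_singleton_iff)
  then have "V \<subseteq> range (\<lambda>c. c *\<^sub>C b)"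
    using B(1) by (simp add: complex_vector.span_singleton)
  then obtain a d where "f = a *\<^sub>C b" "g = d *\<^sub>C b"
    using assms(2,4) by blast
  moreover from this have "a \<noteq> 0" using assms(3) by auto
  ultimately have "g = (d / a) *\<^sub>C f" by (simp add: scaleC_scaleC)
  then show thesis by (rule that)
qed

lemma complex_subspace_plus_space: "complex_vector.subspace (plus_space A)"
proof (rule complex_vector.subspaceI)
  note sub = complex_subspace_adj[of A]
  show "0 \<in> plus_space A"
    using complex_vector.subspace_0[OF sub] by (auto simp: plus_space_def zero_prod_def)
  fix f assume "f \<in> plus_space A"
  then obtain u where fu: "(f, u) \<in> adj A" by (auto simp: plus_space_def)
  then show "c *\<^sub>C f \<in> plus_space A" for c
    using complex_vector.subspace_scale[OF sub fu, of c]
    by (auto simp: plus_space_def scaleC_prod_def)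
  fix g assume "g \<in> plus_space A"
  then obtain v where gv: "(g, v) \<in> adj A" by (auto simp: plus_space_def)
  show "f + g \<in> plus_space A"
    using complex_vector.subspace_add[OF sub fu gv] by (auto simp: plus_space_def)
qed

lemma adj_unique:
  assumes "closure (Domain A) = UNIV" "(g, u) \<in> adj A" "(g, u') \<in> adj A"
  shows "u = u'"
proof -
  have "cinner f (u - u') = 0" if "f \<in> Domain A" for f
    using that assms(2,3) by (force simp: adj_iff cinner_diff_right)
  then have "u - u' = 0" by (rule orthogonal_dense_eq_0[OF assms(1)])
  then show ?thesis by simp
qed

section \<open>State-space operator, channel vector and quasi-kernel\<close>

locale l_system =
  fixes \<Theta> :: "'a::complex_hilbert lsystem"
  assumes is_lsystem: "is_lsystem \<Theta>"
begin

abbreviation "A \<equiv> sym_op \<Theta>"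
abbreviation "T \<equiv> main_op \<Theta>"
abbreviation "B \<equiv> state_op \<Theta>"
abbreviation "Hp \<equiv> plus_space A"
abbreviation "ReB \<equiv> Re_state \<Theta>"
text \<open>The vector chi with \<open>K c = c chi\<close>, seen as the antilinear functional
  \<open>f \<mapsto> (chi, f)\<close>. Hence the adjoint channel sends \<open>f\<close> to
  \<open>cnj (\<phi> f)\<close>.\<close>

definition "\<phi> = channel_op \<Theta> 1"

lemma sym_A: "symmetric_11 A"
  and T_Lambda: "T \<in> Lambda_class A"
  and star_ext: "star_extension A T B"
  and bounded_K: "bounded_channel A (channel_op \<Theta>)"
  and Im_B: "f \<in> Hp \<Longrightarrow> Im_pm A B f = channel_op \<Theta> (channel_adj (channel_op \<Theta>) f)"
  using is_lsystem by (auto simp: is_lsystem_def Let_def)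

lemma dense_A: "closure (Domain A) = UNIV"
  and A_subset_adj: "A \<subseteq> adj A"
  using sym_A by (auto simp: symmetric_11_def)

lemma T_subset_adj: "T \<subseteq> adj A"
  using T_Lambda by (simp add: Lambda_class_def)

lemma bounded_B: "bounded_pm A B"
  and selfadjoint_qk: "selfadjoint (qk \<Theta>)"
  using star_ext by (auto simp: star_extension_def qk_def Re_state_def)

lemma B_T: "(f, u) \<in> T \<Longrightarrow> f \<in> Hp \<and> B f = emb A u"
  and adj_B_A: "(f, u) \<in> A \<Longrightarrow> f \<in> Hp \<and> adj_pm A B f = emb A u"
  and A_subset_T: "A \<subseteq> T"
  using star_ext unfolding star_extension_def extends_pm_def by blast+

lemmas Hp_add = complex_vector.subspace_add[OF complex_subspace_plus_space, of _ A]
lemmas Hp_diff = complex_vector.subspace_diff[OF complex_subspace_plus_space, of _ A]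
lemmas Hp_scaleC = complex_vector.subspace_scale[OF complex_subspace_plus_space, of _ A]

lemma phi_in_minus_space: "\<phi> \<in> minus_space A"
  and channel_op_eq: "channel_op \<Theta> c = (\<lambda>g. c * \<phi> g)"
proof -
  have "\<forall>c d. channel_op \<Theta> (c * d) = (\<lambda>f. c * channel_op \<Theta> d f)"
    using bounded_K by (simp add: bounded_channel_def)
  from this[rule_format, of c 1] show "channel_op \<Theta> c = (\<lambda>g. c * \<phi> g)"
    by (simp add: \<phi>_def)
  show "\<phi> \<in> minus_space A"
    using bounded_K by (simp add: bounded_channel_def \<phi>_def)
qed

lemma channel_adj_eq: "channel_adj (channel_op \<Theta>) f = cnj (\<phi> f)"
  by (simp add: channel_adj_def \<phi>_def)

lemma phi_scaleC: "f \<in> Hp \<Longrightarrow> \<phi> (c *\<^sub>C f) = cnj c * \<phi> f"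
  using phi_in_minus_space by (simp add: minus_space_def)

text \<open>This is \<open>Re A = A - i Im A\<close> with the rank-one imaginary part
  \<open>(., chi) chi\<close> written out.\<close>

lemma ReB_eq:
  assumes "f \<in> Hp"
  shows "ReB f g = B f g - \<i> * cnj (\<phi> f) * \<phi> g"
proof -
  have "(B f g - adj_pm A B f g) / (2 * \<i>) = cnj (\<phi> f) * \<phi> g"
    using fun_cong[OF Im_B[OF assms], of g] by (simp add: Im_pm_def channel_op_eq channel_adj_eq)
  then have "adj_pm A B f g = B f g - 2 * \<i> * cnj (\<phi> f) * \<phi> g"
    by (simp add: field_simps)
  then show ?thesis by (simp add: Re_state_def Re_pm_def)
qed

text \<open>The energy identity, from the rank-one imaginary part evaluated on the diagonal. It
  yields dissipativity and shows when \<open>\<phi>\<close> is nonzero at a vector.\<close>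

lemma B_diag: "f \<in> Hp \<Longrightarrow> Im (B f f) = (cmod (\<phi> f))\<^sup>2"
  using fun_cong[OF Im_B[of f], of f] unfolding cmod_power2
  by (auto simp: Im_pm_def adj_pm_def channel_op_eq channel_adj_eq complex_eq_iff power2_eq_square)

lemma ReB_symmetric: "f \<in> Hp \<Longrightarrow> g \<in> Hp \<Longrightarrow> ReB f g = cnj (ReB g f)"
  by (simp add: Re_state_def Re_pm_def adj_pm_def add.commute)

lemma B_add: "f \<in> Hp \<Longrightarrow> g \<in> Hp \<Longrightarrow> B (f + g) = (\<lambda>h. B f h + B g h)"
  and B_scaleC: "f \<in> Hp \<Longrightarrow> B (c *\<^sub>C f) = (\<lambda>h. c * B f h)"
  using bounded_B by (auto simp: bounded_pm_def)

lemma ReB_add: "f \<in> Hp \<Longrightarrow> g \<in> Hp \<Longrightarrow> ReB (f + g) h = ReB f h + ReB g h"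
  by (auto simp: Re_state_def Re_pm_def adj_pm_def B_add Hp_add add_divide_distrib
      bounded_B[unfolded bounded_pm_def minus_space_def])
    (use bounded_B in \<open>simp add: bounded_pm_def minus_space_def field_simps\<close>)

lemma ReB_scaleC: "f \<in> Hp \<Longrightarrow> ReB (c *\<^sub>C f) h = c * ReB f h"
  using bounded_B
  by (auto simp: Re_state_def Re_pm_def adj_pm_def Hp_scaleC bounded_pm_def minus_space_def
      field_simps)

lemma ReB_diff: "f \<in> Hp \<Longrightarrow> g \<in> Hp \<Longrightarrow> ReB (f - g) h = ReB f h - ReB g h"
  using ReB_add[of "f - g" g h] by (simp add: Hp_diff)

lemma qk_iff: "(f, u) \<in> qk \<Theta> \<longleftrightarrow> f \<in> Hp \<and> ReB f = emb A u"
  by (auto simp: qk_def quasi_kernel_def)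

lemma emb_add: "emb A (u + v) g = emb A u g + emb A v g"
  and emb_diff: "emb A (u - v) g = emb A u g - emb A v g"
  and emb_scaleC: "emb A (c *\<^sub>C u) g = c * emb A u g"
  by (auto simp: emb_def cinner_simps)

lemma emb_inj:
  assumes "emb A u = emb A v"
  shows "u = v"
proof -
  have "cinner f (u - v) = 0" if "f \<in> Domain A" for f
  proof -
    have "f \<in> Hp" using that A_subset_adj by (auto simp: plus_space_def)
    then have "cinner u f = cinner v f" using fun_cong[OF assms, of f] by (simp add: emb_def)
    then show ?thesis by (metis cinner_commute cinner_diff_right eq_iff_diff_eq_0)
  qed
  then have "u - v = 0" by (rule orthogonal_dense_eq_0[OF dense_A])
  then show ?thesis by simp
qed

lemma A_subset_qk: "A \<subseteq> qk \<Theta>"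
proof
  fix x assume "x \<in> A"
  then obtain f u where x: "x = (f, u)" "(f, u) \<in> A" by (metis surj_pair)
  then have "(f, u) \<in> T" using A_subset_T by blast
  then have "B f = emb A u" "f \<in> Hp" using B_T by blast+
  moreover have "adj_pm A B f = emb A u" using adj_B_A x(2) by blast
  ultimately show "x \<in> qk \<Theta>"
    by (simp add: x(1) qk_iff Re_state_def Re_pm_def)
qed

lemma qk_subset_adj: "qk \<Theta> \<subseteq> adj A"
  using adj_antimono[OF A_subset_qk] selfadjoint_qk by (simp add: selfadjoint_in_def)

text \<open>The equation \<open>(Re A - z) f = chi\<close>. As a predicate it keeps existence apart
  from the definite description in \<open>resolvent_pm\<close>, whose value has a meaning only once
  a solution is known.\<close>

definition channel_solution :: "complex \<Rightarrow> 'a \<Rightarrow> bool" where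
  "channel_solution z f \<longleftrightarrow> f \<in> Hp \<and> (\<forall>g. ReB f g - emb A (z *\<^sub>C f) g = \<phi> g)"

text \<open>Two solutions differ by a vector on which the self-adjoint quasi-kernel acts as the
  nonreal number \<open>z\<close>.\<close>

lemma channel_solution_unique:
  assumes "Im z > 0" "channel_solution z f" "channel_solution z g"
  shows "f = g"
proof -
  have fg: "f \<in> Hp" "g \<in> Hp" using assms by (auto simp: channel_solution_def)
  have "ReB (f - g) h = emb A (z *\<^sub>C (f - g)) h" for h
  proof -
    have "ReB f h - emb A (z *\<^sub>C f) h = ReB g h - emb A (z *\<^sub>C g) h"
      using assms by (simp add: channel_solution_def)
    then show ?thesis
      by (simp add: ReB_diff fg emb_scaleC emb_diff algebra_simps)
  qed
  then have "(f - g, z *\<^sub>C (f - g)) \<in> qk \<Theta>"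
    using fg by (simp add: qk_iff Hp_diff fun_eq_iff)
  then have "f - g = 0"
    by (rule selfadjoint_eigenvector_eq_0[OF selfadjoint_qk]) (use assms(1) in simp)
  then show ?thesis by simp
qed

lemma impedance_fun_eq:
  assumes "Im z > 0" "channel_solution z f"
  shows "impedance_fun \<Theta> z = cnj (\<phi> f)"
proof -
  have "resolvent_pm A ReB z \<phi> = f"
    unfolding resolvent_pm_def
    by (rule the_equality)
      (use assms channel_solution_unique[OF assms(1)] in \<open>auto simp: channel_solution_def fun_eq_iff\<close>)
  then show ?thesis by (simp add: impedance_fun_def channel_adj_eq \<phi>_def[symmetric])
qed

text \<open>Applying \<open>Re A - z\<close> to \<open>f\<close> gives
  \<open>chi + (w - z) f\<close>. The error lies in the Hilbert space and is cancelled by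
  \<open>r = (z - w)(S - z)^(-1) f\<close>, where \<open>S\<close> is the quasi-kernel.\<close>

lemma channel_solution_add_resolvent:
  assumes "channel_solution w f" "(r, (z - w) *\<^sub>C f + z *\<^sub>C r) \<in> qk \<Theta>"
  shows "channel_solution z (f + r)"
proof -
  have *: "f \<in> Hp" "\<And>g. ReB f g - w * emb A f g = \<phi> g"
    using assms(1) by (auto simp: channel_solution_def emb_scaleC)
  have r: "r \<in> Hp" "\<And>g. ReB r g = (z - w) * emb A f g + z * emb A r g"
    using assms(2) by (auto simp: qk_iff emb_add emb_scaleC)
  show ?thesis
    unfolding channel_solution_def emb_scaleC emb_add
    using * r by (auto simp: Hp_add ReB_add algebra_simps)
qed

text \<open>Since the state-space operator maps \<open>v\<close> to \<open>u\<close>,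
  \<open>(Re A - i) v\<close> is \<open>u - i v\<close> plus a multiple of chi, nonzero because
  \<open>\<phi> v \<noteq> 0\<close>. A vector \<open>h\<close> in the domain of the quasi-kernel
  removes \<open>u - i v\<close>, and scaling by \<open>c\<close> normalizes the multiple.\<close>

lemma exists_channel_solution:
  assumes v: "(v, u) \<in> T" and pos: "Im (cinner u v) \<noteq> 0"
  obtains f where "channel_solution \<i> f"
proof -
  have vHp: "v \<in> Hp" and Bv: "B v = emb A u" using B_T v by auto
  have "Im (cinner u v) = (cmod (\<phi> v))\<^sup>2"
    using B_diag[OF vHp] vHp by (simp add: Bv emb_def)
  then have phi: "\<phi> v \<noteq> 0" using pos by auto
  obtain h k where hk: "(h, k) \<in> qk \<Theta>" "\<i> *\<^sub>C v - u = k - \<i> *\<^sub>C h"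
    by (rule selfadjoint_surj_shift_i[OF selfadjoint_qk])
  have h: "h \<in> Hp" "\<And>g. ReB h g = emb A k g" using hk(1) by (auto simp: qk_iff)
  define c where "c = 1 / (- \<i> * cnj (\<phi> v))"
  have vh: "v + h \<in> Hp" by (rule Hp_add[OF vHp h(1)])
  have eq: "ReB (v + h) g - emb A (\<i> *\<^sub>C (v + h)) g = - \<i> * cnj (\<phi> v) * \<phi> g" for g
  proof -
    have k: "k = \<i> *\<^sub>C v - u + \<i> *\<^sub>C h" using hk(2) by (simp add: algebra_simps)
    have "emb A k g = \<i> * emb A v g - emb A u g + \<i> * emb A h g"
      by (simp only: k emb_add emb_diff emb_scaleC)
    then show ?thesis
      by (simp add: ReB_add vHp h ReB_eq[OF vHp] Bv emb_add emb_scaleC emb_diff algebra_simps)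
  qed
  have "channel_solution \<i> (c *\<^sub>C (v + h))"
    unfolding channel_solution_def
  proof (intro conjI allI)
    fix g
    have "ReB (c *\<^sub>C (v + h)) g - emb A (\<i> *\<^sub>C c *\<^sub>C (v + h)) g
        = c * (ReB (v + h) g - emb A (\<i> *\<^sub>C (v + h)) g)"
      by (simp only: ReB_scaleC[OF vh] emb_scaleC) (simp add: right_diff_distrib)
    then show "ReB (c *\<^sub>C (v + h)) g - emb A (\<i> *\<^sub>C c *\<^sub>C (v + h)) g = \<phi> g"
      using phi by (simp add: eq c_def)
  qed (rule Hp_scaleC[OF vh])
  then show thesis by (rule that)
qed

text \<open>The vector \<open>f = g + (z - i) r\<close> is the solution at \<open>z\<close>. Pairing
  the equation for \<open>g\<close> with \<open>f\<close> and the equation for \<open>f\<close> with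
  \<open>g\<close>, the symmetry of \<open>Re A\<close> eliminates the unknown value
  \<open>ReB g f\<close>.\<close>

lemma impedance_fun_resolvent:
  assumes z: "Im z > 0" and g: "channel_solution \<i> g" "\<phi> g = - \<i>"
    and r: "(r, g + z *\<^sub>C r) \<in> qk \<Theta>"
  shows "impedance_fun \<Theta> z = - \<i> + (z + \<i>) * cinner (g + (z - \<i>) *\<^sub>C r) g"
proof -
  define f where "f = g + (z - \<i>) *\<^sub>C r"
  have "((z - \<i>) *\<^sub>C r, (z - \<i>) *\<^sub>C (g + z *\<^sub>C r)) \<in> qk \<Theta>"
    using lin_operator_scaleC[OF selfadjoint_imp_lin_operator[OF selfadjoint_qk] r] .
  then have f: "channel_solution z f"
    unfolding f_def
    by (intro channel_solution_add_resolvent[OF g(1)])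
      (simp add: scaleC_add_right scaleC_scaleC mult.commute)
  have Hp: "f \<in> Hp" "g \<in> Hp" using f g by (auto simp: channel_solution_def)
  have "\<phi> f = ReB g f - emb A (\<i> *\<^sub>C g) f" "\<phi> g = ReB f g - emb A (z *\<^sub>C f) g"
    using g(1) f by (simp_all only: channel_solution_def)
  then have "\<phi> f = ReB g f - \<i> * cinner g f" "\<phi> g = ReB f g - z * cinner f g"
    using Hp by (simp_all add: emb_def cinner_scaleC_left)
  moreover have "ReB g f = cnj (ReB f g)" by (rule ReB_symmetric[OF Hp(2,1)])
  moreover have "cinner g f = cnj (cinner f g)" by (rule cinner_commute)
  ultimately have "\<phi> f = cnj (ReB f g) - \<i> * cnj (cinner f g)"
    "ReB f g = z * cinner f g - \<i>"
    by (simp_all only: g(2) eq_diff_eq) (simp only: diff_eq_eq add.commute diff_add_cancel uminus_add_conv_diff)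
  from arg_cong[OF this(1), of cnj] have "cnj (\<phi> f) = ReB f g + \<i> * cinner f g"
    by simp
  also have "\<dots> = - \<i> + (z + \<i>) * cinner f g"
    unfolding \<open>ReB f g = z * cinner f g - \<i>\<close> by (simp add: distrib_right)
  finally have "cnj (\<phi> f) = - \<i> + (z + \<i>) * cinner f g" .
  then show ?thesis
    using impedance_fun_eq[OF z f] by (simp add: f_def)
qed

text \<open>The restriction of the state-space operator to the vectors it sends into the Hilbert
  space extends \<open>T\<close> and is dissipative by \<open>B_diag\<close>, so maximality makes it
  equal to \<open>T\<close>.\<close>

lemma main_op_eq_kernel:
  assumes md: "maximal_dissipative T" and f: "f \<in> Hp" "B f = emb A u"
  shows "(f, u) \<in> T"
proof -
  define T' where "T' = {(f, u). f \<in> Hp \<and> B f = emb A u}"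
  have "lin_operator T'"
    unfolding lin_operator_def
  proof (intro conjI complex_vector.subspaceI)
    show "single_valued T'"
      by (auto simp: T'_def intro!: single_valuedI emb_inj)
    have sc: "c *\<^sub>C x \<in> T'" if "x \<in> T'" for c x
      using that by (auto simp: T'_def scaleC_prod_def Hp_scaleC B_scaleC emb_scaleC fun_eq_iff)
    show "c *\<^sub>C x \<in> T'" if "x \<in> T'" for c x using sc that .
    show "x + y \<in> T'" if "x \<in> T'" "y \<in> T'" for x y
      using that by (auto simp: T'_def Hp_add B_add emb_add fun_eq_iff)
    have "(f, u) \<in> T'" using f by (simp add: T'_def)
    then show "0 \<in> T'" using sc[of "(f, u)" 0] by simp
  qed
  moreover have "T \<subseteq> T'" using B_T by (auto simp: T'_def)
  moreover have "closure (Domain T) = UNIV" using md by (simp add: maximal_dissipative_def dissipative_def)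
  then have "closure (Domain T') = UNIV"
    using \<open>T \<subseteq> T'\<close> by (metis Domain_mono closure_mono top.extremum_uniqueI)
  moreover have "Im (cinner u f) \<ge> 0" if "(f, u) \<in> T'" for f u
    using that B_diag[of f] by (auto simp: T'_def emb_def)
  ultimately have "T' = T"
    using md by (auto simp: maximal_dissipative_def dissipative_def)
  then show ?thesis using f by (auto simp: T'_def)
qed

text \<open>The eigenvector for i is a multiple of \<open>gp\<close>. If \<open>\<kappa>\<close>
  were nonzero, subtracting \<open>gp - \<kappa> gm\<close> from \<open>gp\<close> would put
  \<open>\<kappa> gm\<close> into the domain of \<open>T\<close>, where \<open>T\<close> acts as -i,
  against dissipativity.\<close>

lemma neumann_parameter_eq_0:
  assumes nv: "neumann_vectors A T \<kappa> gp gm" and V: "impedance_fun \<Theta> \<i> = \<i>"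
  shows "\<kappa> = 0"
proof (rule ccontr)
  assume "\<kappa> \<noteq> 0"
  have md: "maximal_dissipative T" and gp: "(gp, \<i> *\<^sub>C gp) \<in> adj A" "norm gp = 1"
    and gm: "(gm, - \<i> *\<^sub>C gm) \<in> adj A" "norm gm = 1" and k: "0 \<le> \<kappa>" "\<kappa> < 1"
    using nv by (auto simp: neumann_vectors_def defect_space_def)
  have diss: "Im (cinner u f) \<ge> 0" if "(f, u) \<in> T" for f u
    using md that by (auto simp: maximal_dissipative_def dissipative_def)
  have linT: "lin_operator T" using md by (simp add: maximal_dissipative_def dissipative_def)
  let ?v = "gp - complex_of_real \<kappa> *\<^sub>C gm" and ?u = "\<i> *\<^sub>C gp - complex_of_real \<kappa> *\<^sub>C (- \<i> *\<^sub>C gm)"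
  obtain u where vu: "(?v, u) \<in> T" using nv by (auto simp: neumann_vectors_def)
  have "(?v, ?u) \<in> adj A"
    using complex_vector.subspace_diff[OF complex_subspace_adj gp(1)
        complex_vector.subspace_scale[OF complex_subspace_adj gm(1), of "of_real \<kappa>"]]
    by (simp add: scaleC_prod_def)
  then have "u = ?u" using adj_unique[OF dense_A] vu T_subset_adj by blast
  then have vu: "(?v, ?u) \<in> T" using vu by simp
  \<comment> \<open>The mixed terms add up to a real number. The positive energy of
    \<open>?v\<close> supplies a channel solution at i, so that the assumption on
    \<open>impedance_fun\<close> speaks about an actual vector.\<close>
  have "Im (cinner ?u ?v) = 1 - \<kappa>\<^sup>2"
    by (simp add: cinner_simps cinner_self gp(2) gm(2) cinner_commute[of gm gp] power2_eq_square
        algebra_simps)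
  then have "Im (cinner ?u ?v) \<noteq> 0" using k by (simp add: power2_eq_1_iff)
  then obtain f where f: "channel_solution \<i> f" using exists_channel_solution[OF vu] by blast
  then have fHp: "f \<in> Hp" by (simp add: channel_solution_def)
  have phi: "\<phi> f = - \<i>"
    using V impedance_fun_eq[OF _ f] by (metis complex_cnj_cnj complex_cnj_i imaginary_unit.sel(2) zero_less_one)
  \<comment> \<open>For \<open>\<phi> f = - i\<close> the real part acts on \<open>f\<close> as
    \<open>A f + chi\<close>, so the channel equation at i says exactly
    \<open>A f = i f\<close>.\<close>
  have "B f = emb A (\<i> *\<^sub>C f)"
    using f ReB_eq[OF fHp] by (simp add: channel_solution_def phi fun_eq_iff)
  then have fT: "(f, \<i> *\<^sub>C f) \<in> T" using main_op_eq_kernel[OF md fHp] by blast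
  have "f \<noteq> 0" using phi phi_scaleC[OF fHp, of 0] by auto
  have "f \<in> defect_space A \<i>" using fT T_subset_adj by (auto simp: defect_space_def)
  moreover have "gp \<in> defect_space A \<i>" using gp(1) by (simp add: defect_space_def)
  moreover have "complex_vector.dim (defect_space A \<i>) = 1"
    using sym_A by (simp add: symmetric_11_def)
  ultimately obtain c where c: "gp = c *\<^sub>C f"
    using complex_dim_1_multiple \<open>f \<noteq> 0\<close> by blast
  then have "(gp, \<i> *\<^sub>C gp) \<in> T"
    using lin_operator_scaleC[OF linT fT, of c] by (simp add: scaleC_scaleC mult.commute)
  from lin_operator_diff[OF linT this vu]
  have "(complex_of_real \<kappa> *\<^sub>C gm, complex_of_real \<kappa> *\<^sub>C (- \<i> *\<^sub>C gm)) \<in> T" by simp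
  from diss[OF this] have "\<kappa> * \<kappa> \<le> 0"
    by (simp add: cinner_simps cinner_self gm(2))
  then show False using \<open>\<kappa> \<noteq> 0\<close> by (auto simp: mult_le_0_iff)
qed

end

text \<open>At \<open>z = i\<close> the kernel reduces to \<open>i / (1 + t^2)\<close>, and the
  normalization of the measure applies.\<close>

lemma donoghue_class_at_i:
  assumes "M \<in> donoghue_class"
  shows "M \<i> = \<i>"
proof -
  obtain \<mu> :: "real measure" where \<mu>: "sets \<mu> = sets borel"
    "(\<integral>\<^sup>+ t. ennreal (1 / (1 + t\<^sup>2)) \<partial>\<mu>) = 1"
    "M \<i> = (\<integral>t. 1 / (complex_of_real t - \<i>) - complex_of_real (t / (1 + t\<^sup>2)) \<partial>\<mu>)"
    using assms unfolding donoghue_class_def by force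
  have [measurable_cong]: "sets \<mu> = sets borel" by (rule \<mu>(1))
  have nonneg: "1 / (1 + t\<^sup>2) \<ge> 0" for t :: real by simp
  have "has_bochner_integral \<mu> (\<lambda>t. 1 / (1 + t\<^sup>2)) 1"
    by (rule has_bochner_integral_nn_integral) (use \<mu>(2) in auto)
  then have "has_bochner_integral \<mu> (\<lambda>t. \<i> * of_real (1 / (1 + t\<^sup>2))) (\<i> * of_real 1)"
    by (intro has_bochner_integral_mult_right has_bochner_integral_of_real)
  moreover have "1 / (complex_of_real t - \<i>) - complex_of_real (t / (1 + t\<^sup>2)) = \<i> * of_real (1 / (1 + t\<^sup>2))"
    for t
  proof -
    have nz: "complex_of_real t - \<i> \<noteq> 0" "complex_of_real t + \<i> \<noteq> 0"
      by (auto simp: complex_eq_iff)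
    have eq: "complex_of_real (1 + t\<^sup>2) = (complex_of_real t - \<i>) * (complex_of_real t + \<i>)"
      by (simp add: power2_eq_square algebra_simps)
    have "1 / d - s / (d * d') = (d' - s) * (1 / (d * d'))" if "d \<noteq> 0" "d' \<noteq> 0" for d d' s :: complex
      using that by (simp add: field_simps)
    from this[OF nz, of "of_real t"] show ?thesis
      unfolding of_real_divide eq by simp
  qed
  ultimately show ?thesis
    using \<mu>(3) by (simp add: has_bochner_integral_iff)
qed

lemma (in l_system) impedance_fun_in_donoghue_class:
  assumes v: "(v, \<i> *\<^sub>C v) \<in> T" "norm v = 1"
  shows "impedance_fun \<Theta> \<in> donoghue_class"
proof -
  have vHp: "v \<in> Hp" and Bv: "B v = emb A (\<i> *\<^sub>C v)" using B_T v(1) by auto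
  have "(cmod (\<phi> v))\<^sup>2 = 1"
    using B_diag[OF vHp] vHp v(2) by (simp add: Bv emb_def cinner_scaleC_left cinner_self)
  then have phi_v: "cmod (\<phi> v) = 1" by (simp add: power2_eq_iff_nonneg[of _ 1, simplified])
  \<comment> \<open>This factor has modulus 1 and gives \<open>\<phi> g = - i\<close>, the value for
    which the eigenvalue equation of \<open>g\<close> is the channel equation at i.\<close>
  define c where "c = \<i> / cnj (\<phi> v)"
  define g where "g = c *\<^sub>C v"
  have phi0: "\<phi> v \<noteq> 0" using phi_v by auto
  have "norm g = 1" using phi_v v(2) by (simp add: g_def c_def norm_scaleC norm_divide)
  have gHp: "g \<in> Hp" using Hp_scaleC[OF vHp] by (simp add: g_def)
  have phi_g: "\<phi> g = - \<i>" using phi0 by (simp add: g_def phi_scaleC[OF vHp] c_def)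
  have "B g = emb A (\<i> *\<^sub>C g)"
    by (simp add: fun_eq_iff g_def B_scaleC[OF vHp] Bv emb_scaleC mult.left_commute)
  then have sol: "channel_solution \<i> g"
    by (simp add: channel_solution_def gHp ReB_eq phi_g)
  have gT: "(g, \<i> *\<^sub>C g) \<in> adj A"
    using complex_vector.subspace_scale[OF complex_subspace_adj, of "(v, \<i> *\<^sub>C v)" A c] v(1) T_subset_adj
    by (auto simp: g_def scaleC_prod_def scaleC_scaleC mult.commute)
  \<comment> \<open>The quasi-kernel and \<open>T\<close> both restrict \<open>adj A\<close>, so
    membership would make \<open>g\<close> an eigenvector of a self-adjoint operator for i.\<close>
  have "g \<notin> Domain (qk \<Theta>)"
  proof
    assume "g \<in> Domain (qk \<Theta>)"
    then obtain u where "(g, u) \<in> qk \<Theta>" by auto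
    moreover from this have "u = \<i> *\<^sub>C g" using qk_subset_adj gT adj_unique[OF dense_A] by blast
    ultimately have "g = 0" using selfadjoint_eigenvector_eq_0[OF selfadjoint_qk, of g \<i>] by simp
    then show False using \<open>norm g = 1\<close> by simp
  qed
  then show ?thesis
    using selfadjoint_resolvent_in_donoghue_class[OF selfadjoint_qk \<open>norm g = 1\<close>]
      impedance_fun_resolvent[OF _ sol phi_g] by blast
qed

section \<open>The eigenvector of a coupling\<close>

lemma defect_vector_direct_sum:
  assumes "gp1 \<in> defect_space A1 z" "gp2 \<in> defect_space A2 z"
  shows "((a *\<^sub>R gp1, b *\<^sub>R gp2), z *\<^sub>C (a *\<^sub>R gp1, b *\<^sub>R gp2)) \<in> adj (direct_sum_op A1 A2)"
  using assms
  by (auto simp: defect_space_def adj_iff direct_sum_op_def cinner_prod_def scaleC_prod_def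
      scaleR_eq_scaleC cinner_scaleC_right)

theorem corollary6p7:
  fixes \<Theta>0 :: "'a::complex_hilbert lsystem"
    and \<Theta>1 :: "'b::complex_hilbert lsystem"
    and \<Theta> :: "('a \<times> 'b) lsystem"
  assumes "minimal_lsystem \<Theta>0"
    and "minimal_lsystem \<Theta>1"
    and "coupling \<Theta>0 \<Theta>1 \<Theta>"
    and "impedance_fun \<Theta>0 \<in> donoghue_class"
  shows "impedance_fun \<Theta> \<in> donoghue_class"
proof -
  interpret \<Theta>0: l_system \<Theta>0
    using assms(1) by unfold_locales (simp add: minimal_lsystem_def)
  obtain \<Theta>0' \<Theta>1' \<Theta>' \<kappa>0 \<kappa>1 gp0 gm0 gp1 gm1 where
    \<Theta>0': "sym_op \<Theta>0' = sym_op \<Theta>0" "main_op \<Theta>0' = main_op \<Theta>0"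
    and cp: "coupling_hyp_I \<Theta>0' \<kappa>0 gp0 gm0 \<Theta>1' \<kappa>1 gp1 gm1 \<Theta>'"
    and \<Theta>: "is_lsystem \<Theta>" "sym_op \<Theta> = sym_op \<Theta>'" "main_op \<Theta> = main_op \<Theta>'"
    using assms(3) unfolding coupling_def by blast
  interpret \<Theta>: l_system \<Theta> using \<Theta>(1) by unfold_locales
  \<comment> \<open>Von Neumann vectors involve only the symmetric and the main operator, which
    \<open>\<Theta>0'\<close> shares with \<open>\<Theta>0\<close>. So the parameter in the coupling
    is governed by the impedance function of \<open>\<Theta>0\<close> itself.\<close>
  have nv0: "neumann_vectors (sym_op \<Theta>0) (main_op \<Theta>0) \<kappa>0 gp0 gm0"
    and nv1: "neumann_vectors (sym_op \<Theta>1') (main_op \<Theta>1') \<kappa>1 gp1 gm1"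
    using cp \<Theta>0' by (auto simp: coupling_hyp_I_def hypothesis_I_def)
  have "\<kappa>0 = 0"
    using \<Theta>0.neumann_parameter_eq_0[OF nv0] donoghue_class_at_i[OF assms(4)] by blast
  obtain \<alpha> \<beta> where "main_op \<Theta>' =
      restrict_op (adj (direct_sum_op (sym_op \<Theta>0') (sym_op \<Theta>1')))
        (add_span (Domain (sym_op \<Theta>')) ((cos \<alpha> *\<^sub>R gp0, - (sin \<alpha> *\<^sub>R gp1)) -
           (\<kappa>0 * \<kappa>1) *\<^sub>R (cos \<beta> *\<^sub>R gm0, - (sin \<beta> *\<^sub>R gm1))))"
    using cp unfolding coupling_hyp_I_def Let_def by blast
  \<comment> \<open>With \<open>\<kappa>0 = 0\<close> the second deficiency vector drops out of the
    spanning vector. The sign is moved into the scalar to fit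
    \<open>defect_vector_direct_sum\<close>.\<close>
  moreover define Gp where "Gp = (cos \<alpha> *\<^sub>R gp0, (- sin \<alpha>) *\<^sub>R gp1)"
  ultimately have main: "main_op \<Theta> =
      restrict_op (adj (direct_sum_op (sym_op \<Theta>0) (sym_op \<Theta>1'))) (add_span (Domain (sym_op \<Theta>)) Gp)"
    using \<open>\<kappa>0 = 0\<close> \<Theta> \<Theta>0' by (simp add: zero_prod_def[symmetric])
  have "Gp \<in> complex_vector.span {Gp}" by (simp add: complex_vector.span_base)
  moreover have "0 \<in> Domain (sym_op \<Theta>)"
    using \<Theta>.sym_A lin_operator_zero by (auto simp: symmetric_11_def)
  ultimately have "Gp \<in> add_span (Domain (sym_op \<Theta>)) Gp"
    unfolding add_span_def mem_Collect_eq by (intro exI[of _ 0] exI[of _ Gp]) simp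
  moreover have "(Gp, \<i> *\<^sub>C Gp) \<in> adj (direct_sum_op (sym_op \<Theta>0) (sym_op \<Theta>1'))"
    unfolding Gp_def
    by (rule defect_vector_direct_sum) (use nv0 nv1 in \<open>auto simp: neumann_vectors_def\<close>)
  ultimately have "(Gp, \<i> *\<^sub>C Gp) \<in> main_op \<Theta>"
    by (simp add: main restrict_op_def)
  moreover have "norm Gp = 1"
    using nv0 nv1 by (simp add: Gp_def norm_prod_def neumann_vectors_def)
  ultimately show ?thesis by (rule \<Theta>.impedance_fun_in_donoghue_class)
qed

end
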